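(* Let $n\ge 1$ and let $\pi$ be a hyperplane of $\mathbb{R}^{n+1}$ not passing through the origin, with chosen Euclidean coordinates. Let $FCF_{n,\pi}\subset FCF_n$ be the chart of ordered collections of $n+1$ independent lines through the origin each of which intersects $\pi$, with coordinates $(x_{1,1},\ldots,x_{n,1},x_{1,2},\ldots,x_{n,n+1})$, where $A_i=(x_{1,i},\ldots,x_{n,i})$ is the intersection point of $\pi$ with the $i$-th line. Consider on $FCF_{n,\pi}$ the form $$\omega_\pi(x_{1,1},\ldots,x_{n,n+1})=\frac{\bigwedge\limits_{i=1}^{n+1}\left(\bigwedge\limits_{j=1}^{n}dx_{j,i}\right)}{V_\pi(A_1\ldots A_{n+1})^{n+1}}.$$ Then the measure $\mu_{\omega_\pi}$ on $FCF_{n,\pi}$ coincides with the restriction to $FCF_{n,\pi}$ of some Möbius measure of $FCF_n$.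
   Context: $FCF_n$ (the manifold of framed $n$-dimensional continued fractions) is the set of ordered collections $(l_1,\ldots,l_{n+1})$ of $n+1$ independent straight lines through the origin in $\mathbb{R}^{n+1}$ (independent: not contained in a common hyperplane). It is an open subset of the product of $n+1$ copies of $\mathbb{R}P^n$, from which it takes its smooth structure. The group $PGL(n+1,\mathbb{R})$ acts on $FCF_n$ by acting on each line. $V_\pi(A_1\ldots A_{n+1})$ denotes the oriented Euclidean volume, in the chosen Euclidean coordinates of the $n$-dimensional plane $\pi$, of the simplex ("tetrahedron") with vertices $A_1,\ldots,A_{n+1}$. It is nonzero at every point of $FCF_{n,\pi}$. For a volume form (form of the highest degree) $\omega$ on a manifold $M$, $\mu_\omega$ is the measure on $M$ determined by $\mu_\omega(S)=\left|\int_S\omega\right|$ for open measurable sets $S$ contained in one connected component of $M$. A Möbius form of $FCF_n$ is a form of the highest degree on $FCF_n$ invariant under the action of $PGL(n+1,\mathbb{R})$. A Möbius measure of $FCF_n$ is a measure of the form $\mu_\omega$ with $\omega$ a Möbius form of $FCF_n$. *)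

theory Defs
  imports "HOL-Analysis.Analysis"
begin

section \<open>Smooth maps and forms of the highest degree in charts\<close>

primrec Ck_on :: "nat \<Rightarrow> ('a::real_normed_vector \<Rightarrow> 'b::real_normed_vector) \<Rightarrow> 'a set \<Rightarrow> bool" where
  "Ck_on 0 f S \<longleftrightarrow> continuous_on S f"
| "Ck_on (Suc k) f S \<longleftrightarrow> (\<forall>x\<in>S. f differentiable (at x)) \<and>
     (\<forall>v. Ck_on k (\<lambda>x. frechet_derivative f (at x) v) S)"

text \<open>\<^term>\<open>S\<close> is meant to be open: derivatives are taken at full neighbourhoods.\<close>

definition smooth_on :: "'a::real_normed_vector set \<Rightarrow> ('a \<Rightarrow> 'b::real_normed_vector) \<Rightarrow> bool" where
  "smooth_on S f \<longleftrightarrow> (\<forall>k. Ck_on k f S)"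

text \<open>
  A chart is its domain together with its coordinate map into \<^typ>\<open>real^'d\<close>. A manifold is given
  by an atlas, a set of charts; its underlying set is the union of the domains, with the topology
  of the ambient type.
\<close>

type_synonym ('p, 'd) chart = "'p set \<times> ('p \<Rightarrow> real^'d)"

definition carrier_of :: "('p, 'd) chart set \<Rightarrow> 'p set" where
  "carrier_of \<A> = (\<Union>c\<in>\<A>. fst c)"

definition chart_inv :: "('p, 'd) chart \<Rightarrow> real^'d \<Rightarrow> 'p" where
  "chart_inv c = the_inv_into (fst c) (snd c)"

text \<open>
  A form of degree \<open>CARD('d)\<close> on a manifold modelled on \<^typ>\<open>real^'d\<close> is given by its local
  expressions: in the chart \<^term>\<open>c\<close> and at the point with coordinates \<open>x\<close>, it is the alternating
  multilinear function \<open>\<omega> c x\<close> of \<open>CARD('d)\<close> tangent vectors. The arguments are indexed by the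
  coordinate index type \<^typ>\<open>'d\<close> itself, so no enumeration of the coordinates has to be chosen.
\<close>

type_synonym ('p, 'd) form = "('p, 'd) chart \<Rightarrow> real^'d \<Rightarrow> ('d \<Rightarrow> real^'d) \<Rightarrow> real"

definition alternating_multilinear :: "(('d \<Rightarrow> real^'d) \<Rightarrow> real) \<Rightarrow> bool" where
  "alternating_multilinear \<eta> \<longleftrightarrow>
     (\<forall>v k. linear (\<lambda>y. \<eta> (v(k := y)))) \<and>
     (\<forall>v k l. k \<noteq> l \<and> v k = v l \<longrightarrow> \<eta> v = 0)"

text \<open>The local form of \<open>g\<^sup>* \<omega> = \<omega>\<close>, read in the chart \<open>c\<close> at the source and \<open>c'\<close> at the target.\<close>

definition pullback_agrees :: "('p, 'd::finite) form \<Rightarrow> ('p \<Rightarrow> 'p) \<Rightarrow> ('p, 'd) chart \<Rightarrow> ('p, 'd) chart \<Rightarrow> bool" where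
  "pullback_agrees \<omega> g c c' \<longleftrightarrow>
     (\<forall>p\<in>fst c. g p \<in> fst c' \<longrightarrow>
        (\<forall>v. \<omega> c (snd c p) v =
             \<omega> c' (snd c' (g p))
               (\<lambda>k. frechet_derivative (snd c' \<circ> g \<circ> chart_inv c) (at (snd c p)) (v k))))"

definition top_form :: "('p, 'd::finite) chart set \<Rightarrow> ('p, 'd) form \<Rightarrow> bool" where
  "top_form \<A> \<omega> \<longleftrightarrow>
     (\<forall>c\<in>\<A>. \<forall>x\<in>snd c ` fst c. alternating_multilinear (\<omega> c x)) \<and>
     (\<forall>c\<in>\<A>. \<forall>v. smooth_on (snd c ` fst c) (\<lambda>x. \<omega> c x v)) \<and>
     (\<forall>c\<in>\<A>. \<forall>c'\<in>\<A>. pullback_agrees \<omega> id c c')"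

definition invariant_form :: "('p, 'd::finite) chart set \<Rightarrow> ('p \<Rightarrow> 'p) \<Rightarrow> ('p, 'd) form \<Rightarrow> bool" where
  "invariant_form \<A> g \<omega> \<longleftrightarrow> (\<forall>c\<in>\<A>. \<forall>c'\<in>\<A>. pullback_agrees \<omega> g c c')"


section \<open>Integration of forms and the measure of a form\<close>

text \<open>
  An orientation of an open part \<open>C\<close> of a manifold: \<open>\<sigma> c p\<close> is \<open>1\<close> or \<open>-1\<close> according to whether
  the chart \<open>c\<close> is positively or negatively oriented at \<open>p\<close>. Chart domains need not be connected,
  which is why the sign may depend on the point.
\<close>

definition orientation_on :: "('p::topological_space, 'd::finite) chart set \<Rightarrow> 'p set \<Rightarrow>
    (('p, 'd) chart \<Rightarrow> 'p \<Rightarrow> real) \<Rightarrow> bool" where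
  "orientation_on \<A> C \<sigma> \<longleftrightarrow>
     (\<forall>c\<in>\<A>. continuous_on (C \<inter> fst c) (\<sigma> c) \<and> (\<forall>p\<in>C \<inter> fst c. \<sigma> c p \<in> {1, -1})) \<and>
     (\<forall>c\<in>\<A>. \<forall>c'\<in>\<A>. \<forall>p\<in>C \<inter> fst c \<inter> fst c'.
        \<sigma> c' p = sgn (det (matrix (frechet_derivative (snd c' \<circ> chart_inv c) (at (snd c p))))) * \<sigma> c p)"

definition coefficient :: "('p, 'd::finite) form \<Rightarrow> ('p, 'd) chart \<Rightarrow> real^'d \<Rightarrow> real" where
  "coefficient \<omega> c x = \<omega> c x (\<lambda>k. axis k 1)"

definition chart_cover :: "('p, 'd) chart set \<Rightarrow> 'p set \<Rightarrow> (nat \<Rightarrow> ('p, 'd) chart) \<Rightarrow> bool" where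
  "chart_cover \<A> S c \<longleftrightarrow> range c \<subseteq> \<A> \<and> S \<subseteq> (\<Union>k. fst (c k))"

text \<open>
  The integral of \<open>s * \<omega>\<close> over \<open>S\<close>, positive part only: \<open>S\<close> is cut into countably many disjoint
  Borel pieces, each inside one chart, and the pieces are integrated in coordinates. The value does
  not depend on the countable cover by charts, provided \<open>s\<close> is an orientation.
\<close>

definition positive_integral ::
    "('p, 'd::finite) chart set \<Rightarrow> (('p, 'd) chart \<Rightarrow> 'p \<Rightarrow> real) \<Rightarrow> ('p, 'd) form \<Rightarrow> 'p set \<Rightarrow> ennreal" where
  "positive_integral \<A> s \<omega> S =
     (let c = (SOME c. chart_cover \<A> S c) in
        \<Sum>k. \<integral>\<^sup>+x \<in> snd (c k) ` (S \<inter> disjointed (\<lambda>i. fst (c i)) k).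
               ennreal (s (c k) (chart_inv (c k) x) * coefficient \<omega> (c k) x) \<partial>lborel)"

text \<open>
  The integral of \<open>\<omega>\<close> over \<open>S\<close> with respect to the orientation \<open>\<sigma>\<close>, as an extended real; it may be
  infinite. (When both parts are infinite the integral has no meaning; this does not happen for
  nowhere vanishing forms on a connected set.)
\<close>

definition form_integral ::
    "('p, 'd::finite) chart set \<Rightarrow> (('p, 'd) chart \<Rightarrow> 'p \<Rightarrow> real) \<Rightarrow> ('p, 'd) form \<Rightarrow> 'p set \<Rightarrow> ereal" where
  "form_integral \<A> \<sigma> \<omega> S =
     enn2ereal (positive_integral \<A> \<sigma> \<omega> S) - enn2ereal (positive_integral \<A> (\<lambda>c p. - \<sigma> c p) \<omega> S)"

text \<open>
  \<open>\<mu>\<close> is the measure of the form \<open>\<omega>\<close>. On a connected component there are only two orientations,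
  and they give integrals of opposite sign, so the choice of \<open>\<sigma>\<close> is immaterial.
\<close>

definition is_form_measure ::
    "('p::topological_space, 'd::finite) chart set \<Rightarrow> ('p, 'd) form \<Rightarrow> 'p measure \<Rightarrow> bool" where
  "is_form_measure \<A> \<omega> \<mu> \<longleftrightarrow>
     space \<mu> = carrier_of \<A> \<and>
     sets \<mu> = sets (restrict_space borel (carrier_of \<A>)) \<and>
     (\<forall>C\<in>components (carrier_of \<A>). \<exists>\<sigma>. orientation_on \<A> C \<sigma> \<and>
        (\<forall>S. openin (top_of_set (carrier_of \<A>)) S \<and> S \<subseteq> C \<longrightarrow>
           enn2ereal (emeasure \<mu> S) = \<bar>form_integral \<A> \<sigma> \<omega> S\<bar>))"


section \<open>Real projective space\<close>

typedef (overloaded) ('m::finite) proj = "{L :: (real^'m) set. subspace L \<and> dim L = 1}"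
  morphisms line_set Proj
proof -
  let ?u = "axis undefined 1 :: real^'m"
  have "?u \<noteq> 0" by (simp only: axis_eq_0_iff one_neq_zero not_False_eq_True)
  then have "independent {?u}" by (simp only: dependent_single not_False_eq_True)
  then have "dim (span {?u}) = card {?u}" by (rule dim_span_eq_card_independent)
  then have "dim (span {?u}) = 1" by (simp only: card.insert finite.emptyI empty_iff not_False_eq_True card.empty One_nat_def)
  then show ?thesis using subspace_span by blast
qed

text \<open>The topology is the quotient topology under \<open>x \<mapsto> span {x}\<close>, \<open>x \<noteq> 0\<close>.\<close>

instantiation proj :: (finite) topological_space
begin

definition open_proj :: "'a proj set \<Rightarrow> bool" where
  "open_proj U \<longleftrightarrow> open {x :: real^'a. x \<noteq> 0 \<and> Proj (span {x}) \<in> U}"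

instance
proof
  have "{x :: real^'a. x \<noteq> 0} = - {0}" by auto
  then show "open (UNIV :: 'a proj set)"
    by (simp add: open_proj_def open_Compl)
next
  fix S T :: "'a proj set"
  assume "open S" "open T"
  moreover have "{x :: real^'a. x \<noteq> 0 \<and> Proj (span {x}) \<in> S \<inter> T} =
      {x. x \<noteq> 0 \<and> Proj (span {x}) \<in> S} \<inter> {x. x \<noteq> 0 \<and> Proj (span {x}) \<in> T}"
    by auto
  ultimately show "open (S \<inter> T)"
    unfolding open_proj_def by (simp only: open_Int)
next
  fix K :: "'a proj set set"
  assume K: "\<forall>S\<in>K. open S"
  have "{x :: real^'a. x \<noteq> 0 \<and> Proj (span {x}) \<in> \<Union>K} =
      (\<Union>S\<in>K. {x. x \<noteq> 0 \<and> Proj (span {x}) \<in> S})"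
    by auto
  moreover have "open (\<Union>S\<in>K. {x :: real^'a. x \<noteq> 0 \<and> Proj (span {x}) \<in> S})"
    using K unfolding open_proj_def by (intro open_UN) simp
  ultimately show "open (\<Union>K)"
    unfolding open_proj_def by (simp only:)
qed

end


section \<open>The manifold of framed continued fractions\<close>

text \<open>
  Throughout, \<open>n = CARD('n)\<close>, \<open>\<real>\<^sup>n\<^sup>+\<^sup>1\<close> is \<^typ>\<open>real^'n option\<close>, and the \<open>n + 1\<close> lines are indexed by
  \<^typ>\<open>'n option\<close> as well. The topology of \<^typ>\<open>'m proj ^ 'k\<close> is the product topology.
\<close>

definition FCF :: "('n::finite option proj ^ 'n option) set" where
  "FCF = {l. \<not> (\<exists>a :: real^'n option. a \<noteq> 0 \<and> (\<forall>i. line_set (l $ i) \<subseteq> {x. a \<bullet> x = 0}))}"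

text \<open>\<open>P\<close> is a hyperplane not through the origin, and \<open>e\<close> is a Euclidean coordinate system on it.\<close>

definition euclidean_hyperplane ::
    "(real^'n::finite option) set \<Rightarrow> (real^'n option \<Rightarrow> real^'n) \<Rightarrow> bool" where
  "euclidean_hyperplane P e \<longleftrightarrow>
     affine P \<and> aff_dim P = int CARD('n) \<and> 0 \<notin> P \<and>
     bij_betw e P UNIV \<and> (\<forall>x\<in>P. \<forall>y\<in>P. dist (e x) (e y) = dist x y)"

definition line_coords ::
    "(real^'n::finite option) set \<Rightarrow> (real^'n option \<Rightarrow> real^'n) \<Rightarrow> 'n option proj \<Rightarrow> real^'n" where
  "line_coords P e L = e (THE A. A \<in> line_set L \<inter> P)"

text \<open>
  The \<open>i\<close>-th line is described by its intersection with the hyperplane \<open>P i\<close>. The coordinate with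
  index \<open>(j, i)\<close> is \<open>x\<^sub>j\<^sub>,\<^sub>i\<close>. Varying \<open>P\<close> and \<open>e\<close> gives the products of affine charts of projective
  space; the chart of a single hyperplane has constant \<open>P\<close> and \<open>e\<close>.
\<close>

definition FCF_chart ::
    "('n option \<Rightarrow> (real^'n::finite option) set) \<Rightarrow> ('n option \<Rightarrow> real^'n option \<Rightarrow> real^'n) \<Rightarrow>
     ('n option proj ^ 'n option, 'n \<times> 'n option) chart" where
  "FCF_chart P e =
     ({l \<in> FCF. \<forall>i. line_set (l $ i) \<inter> P i \<noteq> {}},
      \<lambda>l. \<chi> q. line_coords (P (snd q)) (e (snd q)) (l $ snd q) $ fst q)"

definition FCF_atlas :: "('n::finite option proj ^ 'n option, 'n \<times> 'n option) chart set" where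
  "FCF_atlas = {FCF_chart P e | P e. \<forall>i. euclidean_hyperplane (P i) (e i)}"

definition FCF_plane :: "(real^'n::finite option) set \<Rightarrow> ('n option proj ^ 'n option) set" where
  "FCF_plane P = {l \<in> FCF. \<forall>i. line_set (l $ i) \<inter> P \<noteq> {}}"

text \<open>The open submanifold \<^term>\<open>FCF_plane P\<close>, with its global coordinates.\<close>

definition FCF_plane_atlas ::
    "(real^'n::finite option) set \<Rightarrow> (real^'n option \<Rightarrow> real^'n) \<Rightarrow>
     ('n option proj ^ 'n option, 'n \<times> 'n option) chart set" where
  "FCF_plane_atlas P e = {(FCF_plane P, snd (FCF_chart (\<lambda>_. P) (\<lambda>_. e)))}"


section \<open>The projective group and Moebius forms\<close>

definition PGL :: "(real^'m::finite^'m) set set" where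
  "PGL = {A. invertible A} //
     {(A, B). invertible A \<and> invertible B \<and> (\<exists>t. t \<noteq> 0 \<and> B = t *\<^sub>R A)}"

text \<open>All representatives of \<open>G\<close> map a given line to the same line, so the union is a line.\<close>

definition PGL_line :: "(real^'m::finite^'m) set \<Rightarrow> 'm proj \<Rightarrow> 'm proj" where
  "PGL_line G L = Proj (\<Union>A\<in>G. (\<lambda>x. A *v x) ` line_set L)"

definition PGL_FCF :: "(real^'n::finite option^'n option) set \<Rightarrow>
    'n option proj ^ 'n option \<Rightarrow> 'n option proj ^ 'n option" where
  "PGL_FCF G l = (\<chi> i. PGL_line G (l $ i))"

definition Moebius_form :: "('n::finite option proj ^ 'n option, 'n \<times> 'n option) form \<Rightarrow> bool" where
  "Moebius_form \<omega> \<longleftrightarrow> top_form FCF_atlas \<omega> \<and> (\<forall>G\<in>PGL. invariant_form FCF_atlas (PGL_FCF G) \<omega>)"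

definition Moebius_measure :: "('n::finite option proj ^ 'n option) measure \<Rightarrow> bool" where
  "Moebius_measure \<nu> \<longleftrightarrow> (\<exists>\<omega>. Moebius_form \<omega> \<and> is_form_measure FCF_atlas \<omega> \<nu>)"


section \<open>The form of a hyperplane\<close>

text \<open>The vertex \<open>A None\<close> comes first; the other ordering conventions change only the sign.\<close>

definition oriented_volume :: "('n::finite option \<Rightarrow> real^'n) \<Rightarrow> real" where
  "oriented_volume A = det (\<chi> i. A (Some i) - A None) / fact CARD('n)"

text \<open>The wedge product of \<open>CARD('d)\<close> covectors, in the normalisation without a factorial.\<close>

definition wedge :: "('d::finite \<Rightarrow> real^'d \<Rightarrow> real) \<Rightarrow> ('d \<Rightarrow> real^'d) \<Rightarrow> real" where
  "wedge \<alpha> v = det (\<chi> k l. \<alpha> l (v k))"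

definition dx :: "'d \<Rightarrow> real^'d \<Rightarrow> real" where
  "dx q v = v $ q"

text \<open>
  The form \<open>\<omega>\<^sub>\<pi>\<close>, in the coordinates of \<^const>\<open>FCF_plane_atlas\<close> (the only chart there, hence the
  unused argument).
\<close>

definition omega_plane :: "('n::finite option proj ^ 'n option, 'n \<times> 'n option) form" where
  "omega_plane _ x v = wedge dx v / oriented_volume (\<lambda>i. \<chi> j. x $ (j, i)) ^ (CARD('n) + 1)"

end

theory Submission
  imports Defs
begin

text \<open>
  Choose a spanning vector \<open>v i\<close> of each line. The expression
  \<open>(\<Prod>i. det (v i, dv i, \<dots>, dv i)) / det (v 1, \<dots>, v (n + 1)) ^ (n + 1)\<close>
  does not change when one \<open>v i\<close> is rescaled, since numerator and denominator both acquire the factor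
  \<open>t ^ (n + 1)\<close>; hence it is a form on the manifold of frames. Applying a matrix \<open>A\<close> multiplies numerator
  and denominator by \<open>det A ^ (n + 1)\<close>, so the form is invariant under the projective group. If all \<open>v i\<close>
  are taken on a hyperplane \<open>P\<close>, each factor of the numerator is a constant multiple of the coordinate volume
  form of \<open>P\<close>, and the determinant in the denominator is a constant multiple of the volume of the simplex
  with vertices \<open>v i\<close>. So up to a constant this form is \<^const>\<open>omega_plane\<close>.

  In coordinates, a hyperplane with Euclidean coordinates is the image of the vectors \<open>(1, x)\<close> under an
  invertible matrix (\<open>euclidean_hyperplane_affine_frame\<close>), and both changes of charts and projective maps
  become products of fractional linear maps. Their Jacobians (\<open>det_proj_deriv\<close>, \<open>det_block_diagonal\<close>) give
  the transformation law of the coefficient of the form (\<open>frame_coefficient_transition\<close>), from which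
  \<open>Moebius_form_the_moebius_form\<close> follows.

  As the form vanishes nowhere, the sign of its coefficient orients the manifold, and the integral of the form
  with this orientation is the integral of the absolute value of the coefficient. The resulting measure can be
  read off in a single chart: two charts give a set in their intersection the same mass by change of
  variables, and the frames that one chart omits form a null set in the other
  (\<open>chart_mass_change_of_chart\<close>). Taking the chart of \<open>P\<close> as the single chart gives a Moebius measure whose
  restriction is a measure of \<^const>\<open>omega_plane\<close>.

  Conversely, a measure of \<^const>\<open>omega_plane\<close> is determined by the form (\<open>form_measure_unique\<close>): its value
  on an open box in the coordinates is forced, because a box lies in one connected component and there any two
  orientations differ by a constant sign.
\<close>

section \<open>Determinants of embedded, block diagonal and bordered matrices\<close>

lemma sum_UNIV_option:
  fixes f :: "'n::finite option \<Rightarrow> 'b::comm_monoid_add"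
  shows "sum f UNIV = f None + (\<Sum>j\<in>UNIV. f (Some j))"
  by (simp add: UNIV_option_conv sum.reindex)

text \<open>
  The entries of \<^term>\<open>M\<close> are placed in the rows and columns in the range of \<^term>\<open>f\<close>, and the
  identity matrix elsewhere. Both the diagonal blocks of a matrix over \<open>'n \<times> 'k\<close>
  (\<open>f j = (j, i)\<close>) and the lower right corner of a matrix over \<open>'n option\<close> (\<open>f = Some\<close>) are
  of this kind.
\<close>

definition embed_block :: "('a::finite \<Rightarrow> 'b::finite) \<Rightarrow> real^'a^'a \<Rightarrow> real^'b^'b" where
  "embed_block f M = (\<chi> p q. if p \<in> range f \<and> q \<in> range f then M $ inv f p $ inv f q else of_bool (p = q))"

lemma embed_block_mult:
  assumes "inj f"
  shows "embed_block f (A ** B) = embed_block f A ** embed_block f B"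
proof -
  have "embed_block f (A ** B) $ p $ q = (embed_block f A ** embed_block f B) $ p $ q" for p q
  proof -
    let ?g = "\<lambda>r. embed_block f A $ p $ r * embed_block f B $ r $ q"
    have "(embed_block f A ** embed_block f B) $ p $ q = sum ?g (range f \<union> - range f)"
      by (simp add: matrix_matrix_mult_def)
    also have "\<dots> = sum ?g (range f) + sum ?g (- range f)"
      by (rule sum.union_disjoint) auto
    also have "sum ?g (range f) = (\<Sum>k\<in>UNIV. ?g (f k))"
      by (simp add: sum.reindex assms)
    also have "\<dots> = (if p \<in> range f \<and> q \<in> range f then (A ** B) $ inv f p $ inv f q else 0)"
      using assms by (auto simp: embed_block_def matrix_matrix_mult_def intro!: sum.neutral)
    also have "sum ?g (- range f) = (if p \<in> range f \<and> q \<in> range f then 0 else of_bool (p = q))"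
    proof (cases "p \<in> range f")
      case True
      then show ?thesis by (auto simp: embed_block_def intro!: sum.neutral)
    next
      case False
      then have "sum ?g (- range f) = (\<Sum>r\<in>- range f. if p = r then of_bool (r = q) else 0)"
        by (intro sum.cong) (auto simp: embed_block_def)
      also have "\<dots> = of_bool (p = q)" using False by (simp add: sum.delta)
      finally show ?thesis using False by simp
    qed
    finally show ?thesis by (auto simp: embed_block_def)
  qed
  then show ?thesis by (simp add: vec_eq_iff)
qed

lemma det_idplus:
  fixes c :: real
  assumes "m \<noteq> n"
  shows "det (\<chi> i j. if i = m \<and> j = n then c else of_bool (i = j) :: real^'n^'n) = 1"
proof -
  have "(\<chi> i j. if i = m \<and> j = n then c else of_bool (i = j) :: real^'n^'n)
      = (\<chi> k. if k = m then row m (mat 1) + c *s row n (mat 1) else row k (mat 1))"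
    using assms by (auto simp: vec_eq_iff row_def mat_def)
  then show ?thesis by (simp only: det_row_operation[OF assms] det_I)
qed

text \<open>
  Embedding is multiplicative, so it suffices to compare both sides on elementary matrices, and the
  embedding of an elementary matrix is an elementary matrix of the same sort.
\<close>

lemma det_embed_block:
  assumes f: "inj f"
  shows "det (embed_block f M) = det M"
proof (rule induct_matrix_elementary[of "\<lambda>M. det (embed_block f M) = det M"])
  fix A B :: "real^'a^'a"
  assume "det (embed_block f A) = det A" "det (embed_block f B) = det B"
  then show "det (embed_block f (A ** B)) = det (A ** B)" by (simp add: embed_block_mult f det_mul)
next
  fix A :: "real^'a^'a" and i
  assume zero_row: "row i A = 0"
  then have "row (f i) (embed_block f A) = 0"
    using f by (auto simp: row_def embed_block_def vec_eq_iff)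
  with zero_row show "det (embed_block f A) = det A" by (metis det_zero_row(2))
next
  fix A :: "real^'a^'a"
  assume diagonal: "\<And>i j. i \<noteq> j \<Longrightarrow> A $ i $ j = 0"
  then have "embed_block f A $ p $ q = 0" if "p \<noteq> q" for p q
    using that f by (auto simp: embed_block_def intro!: diagonal)
  then have "det (embed_block f A) = (\<Prod>p\<in>range f \<union> - range f. embed_block f A $ p $ p)"
    by (simp add: det_diagonal)
  also have "\<dots> = (\<Prod>p\<in>range f. embed_block f A $ p $ p) * (\<Prod>p\<in>- range f. embed_block f A $ p $ p)"
    by (rule prod.union_disjoint) auto
  also have "(\<Prod>p\<in>- range f. embed_block f A $ p $ p) = 1"
    by (rule prod.neutral) (auto simp: embed_block_def)
  also have "(\<Prod>p\<in>range f. embed_block f A $ p $ p) = (\<Prod>i\<in>UNIV. A $ i $ i)"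
    using f by (simp add: prod.reindex embed_block_def)
  finally show "det (embed_block f A) = det A" using diagonal by (simp add: det_diagonal)
next
  fix m n :: 'a
  assume swap1: "m \<noteq> n"
  have inv: "Transposition.transpose (f m) (f n) q = f (Transposition.transpose m n (inv f q))" if "q \<in> range f" for q
    using that f by (auto simp: Transposition.transpose_def inj_eq)
  have out: "Transposition.transpose (f m) (f n) q = q" if "q \<notin> range f" for q
    using that by (auto simp: Transposition.transpose_def)
  have E: "embed_block f (\<chi> i j. mat 1 $ i $ Transposition.transpose m n j)
     = (\<chi> p q. mat 1 $ p $ Transposition.transpose (f m) (f n) q)"
  proof -
    have "embed_block f (\<chi> i j. mat 1 $ i $ Transposition.transpose m n j) $ p $ q
     = mat 1 $ p $ Transposition.transpose (f m) (f n) q" for p q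
      using f inv[of q] out[of q]
      by (cases "q \<in> range f"; cases "p \<in> range f") (auto simp: embed_block_def mat_def inj_eq)
    then show ?thesis by (simp add: vec_eq_iff)
  qed
  have "f m \<noteq> f n" using swap1 f by (simp add: inj_eq)
  then show "det (embed_block f (\<chi> i j. mat 1 $ i $ Transposition.transpose m n j))
      = det (\<chi> i j. mat 1 $ i $ Transposition.transpose m n j :: real^'a^'a)" using swap1
    unfolding E by (simp add: det_permute_columns permutes_swap_id sign_swap_id)
next
  fix m n :: 'a and c :: real
  assume idplus: "m \<noteq> n"
  have E: "embed_block f (\<chi> i j. if i = m \<and> j = n then c else of_bool (i = j))
    = (\<chi> p q. if p = f m \<and> q = f n then c else of_bool (p = q))"
    using f by (auto simp: embed_block_def vec_eq_iff inj_eq)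
  have "f m \<noteq> f n" using idplus f by (simp add: inj_eq)
  then show "det (embed_block f (\<chi> i j. if i = m \<and> j = n then c else of_bool (i = j)))
      = det (\<chi> i j. if i = m \<and> j = n then c else of_bool (i = j) :: real^'a^'a)"
    using idplus unfolding E by (simp add: det_idplus)
qed

definition block_diagonal :: "('k::finite \<Rightarrow> real^'n::finite^'n) \<Rightarrow> real^('n \<times> 'k)^('n \<times> 'k)" where
  "block_diagonal M = (\<chi> p q. if snd p = snd q then M (snd p) $ fst p $ fst q else 0)"

lemma block_diagonal_mult:
  "block_diagonal (\<lambda>i. A i ** B i) = block_diagonal A ** block_diagonal B"
proof -
  have "(block_diagonal A ** block_diagonal B) $ p $ q = block_diagonal (\<lambda>i. A i ** B i) $ p $ q" for p q
  proof -
    have "(block_diagonal A ** block_diagonal B) $ p $ q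
       = (\<Sum>r\<in>UNIV \<times> UNIV. block_diagonal A $ p $ r * block_diagonal B $ r $ q)"
      by (simp add: matrix_matrix_mult_def)
    also have "\<dots> = (\<Sum>j\<in>UNIV. \<Sum>i\<in>UNIV. block_diagonal A $ p $ (j, i) * block_diagonal B $ (j, i) $ q)"
      by (simp add: sum.cartesian_product del: UNIV_Times_UNIV)
    also have "\<dots> = (\<Sum>j\<in>UNIV. \<Sum>i\<in>UNIV. if snd p = i then A i $ fst p $ j * block_diagonal B $ (j, i) $ q else 0)"
      by (intro sum.cong) (auto simp: block_diagonal_def)
    also have "\<dots> = block_diagonal (\<lambda>i. A i ** B i) $ p $ q"
      by (auto simp: sum.delta block_diagonal_def matrix_matrix_mult_def)
    finally show ?thesis .
  qed
  then show ?thesis by (simp add: vec_eq_iff)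
qed

text \<open>
  A block diagonal matrix is the product, over its blocks, of the matrices with one block embedded.
\<close>

lemma det_block_diagonal:
  fixes M :: "'k::finite \<Rightarrow> real^'n::finite^'n"
  shows "det (block_diagonal M) = (\<Prod>i\<in>UNIV. det (M i))"
proof -
  have "det (block_diagonal (\<lambda>i. if i \<in> S then M i else mat 1)) = (\<Prod>i\<in>S. det (M i))" if "finite S" for S
    using that
  proof induction
    case empty
    have "block_diagonal (\<lambda>i::'k. mat 1 :: real^'n^'n) = mat 1"
      by (auto simp: block_diagonal_def mat_def vec_eq_iff)
    then show ?case by simp
  next
    case (insert a S)
    let ?f = "\<lambda>j::'n. (j, a)"
    have "(\<lambda>i. if i \<in> insert a S then M i else mat 1)
       = (\<lambda>i. (if i = a then M i else mat 1) ** (if i \<in> S then M i else mat 1))"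
      using insert by auto
    moreover have "block_diagonal (\<lambda>i. if i = a then M i else mat 1) = embed_block ?f (M a)"
    proof -
      have "inv ?f (j, a) = j" for j by (rule inv_f_f) (simp add: inj_on_def)
      then show ?thesis
        by (auto simp: block_diagonal_def embed_block_def vec_eq_iff mat_def)
    qed
    moreover have "inj ?f" by (simp add: inj_on_def)
    ultimately show ?case
      using insert by (simp add: block_diagonal_mult det_mul det_embed_block)
  qed
  from this[of UNIV] show ?thesis by simp
qed

lemma det_first_row:
  fixes w :: real and r :: "real^'n::finite"
  shows "det (\<chi> p q. if p = None then (case q of None \<Rightarrow> w | Some j \<Rightarrow> r $ j) else of_bool (p = q)
     :: real^'n option^'n option) = w" (is "det ?R = w")
proof -
  let ?A = "\<chi> p q. if p = q then (if p = None then w else 1) else 0 :: real^'n option^'n option"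
  let ?x = "\<Sum>j\<in>UNIV. (r $ j) *s row (Some j) ?A"
  have x: "?x \<in> vec.span {row j ?A |j. j \<noteq> None}"
    by (intro vec.span_sum vec.span_scale vec.span_base) auto
  have xv: "?x $ q = (case q of None \<Rightarrow> 0 | Some j \<Rightarrow> r $ j)" for q
    by (auto simp: row_def if_distrib[of "\<lambda>z. _ * z"] split: option.split cong: if_cong)
  have "?R = (\<chi> k. if k = None then row None ?A + ?x else row k ?A)"
    unfolding vec_eq_iff using xv by (auto simp: row_def split: option.split)
  then have "det ?R = det ?A" by (simp only: det_row_span[OF x])
  also have "\<dots> = w"
    by (subst det_diagonal) (auto simp: UNIV_option_conv prod.reindex)
  finally show ?thesis .
qed

text \<open>
  The matrix factors as the embedded corner times a matrix that differs from the identity in its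
  first row only.
\<close>

lemma det_corner:
  fixes A :: "real^'n::finite option^'n option"
  assumes "\<And>j. A $ Some j $ None = 0"
  shows "det A = A $ None $ None * det (\<chi> j k. A $ Some j $ Some k)"
proof -
  let ?M = "\<chi> j k. A $ Some j $ Some k"
  let ?R = "\<chi> p q. if p = None then (case q of None \<Rightarrow> A $ None $ None | Some j \<Rightarrow> (\<chi> k. A $ None $ Some k) $ j)
     else of_bool (p = q) :: real^'n option^'n option"
  have inj: "inj (Some :: 'n \<Rightarrow> 'n option)" by simp
  have inv: "inv Some (Some j) = j" for j :: 'n using inj by (rule inv_f_f)
  have "A $ p $ q = (embed_block Some ?M ** ?R) $ p $ q" for p q
    using assms
    by (cases p; cases q)
      (auto simp: matrix_matrix_mult_def sum_UNIV_option embed_block_def inv of_bool_def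
         if_distrib[of "\<lambda>z. _ * z"] cong: if_cong)
  then have "A = embed_block Some ?M ** ?R" unfolding vec_eq_iff by blast
  then have "det A = det (embed_block Some ?M ** ?R)" by (rule arg_cong)
  also have "\<dots> = det ?M * A $ None $ None"
    unfolding det_mul det_embed_block[OF inj] det_first_row ..
  finally show ?thesis by simp
qed

text \<open>
  The unipotent matrix with first column \<open>(1, c)\<close>. Multiplying by it from the left adds multiples of
  the first row to the others; multiplying from the right replaces the first column by a combination
  of all columns. Neither changes the determinant.
\<close>

definition col_shear :: "real^'n::finite \<Rightarrow> real^'n option^'n option" where
  "col_shear c = (\<chi> p q. if q = None then (case p of None \<Rightarrow> 1 | Some j \<Rightarrow> c $ j) else of_bool (p = q))"

lemma det_col_shear: "det (col_shear c) = 1"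
proof -
  have "Finite_Cartesian_Product.transpose (col_shear c) =
     (\<chi> p q. if p = None then (case q of None \<Rightarrow> 1 | Some j \<Rightarrow> c $ j) else of_bool (p = q))"
    by (auto simp: col_shear_def Finite_Cartesian_Product.transpose_def vec_eq_iff)
  then have "det (Finite_Cartesian_Product.transpose (col_shear c)) = 1"
    by (simp only: det_first_row)
  then show ?thesis by (simp only: det_transpose)
qed

lemma col_shear_mult:
  "(col_shear c ** A) $ p $ q = (case p of None \<Rightarrow> A $ None $ q | Some j \<Rightarrow> c $ j * A $ None $ q + A $ Some j $ q)"
  by (auto simp: col_shear_def matrix_matrix_mult_def sum_UNIV_option of_bool_def
     if_distrib[of "\<lambda>z. z * _"] split: option.split cong: if_cong)

section \<open>Projective maps in an affine chart\<close>

text \<open>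
  The affine chart of projective space and its inverse: \<open>x\<close> goes to \<open>(1, x)\<close>, and a vector with
  nonzero coordinate at \<^const>\<open>None\<close> is rescaled to this form.
\<close>

definition hom :: "real^'n::finite \<Rightarrow> real^'n option" where
  "hom x = (\<chi> q. case q of None \<Rightarrow> 1 | Some j \<Rightarrow> x $ j)"

definition dehom :: "real^'n::finite option \<Rightarrow> real^'n" where
  "dehom y = (\<chi> j. y $ Some j / y $ None)"

lemma hom_nth [simp]: "hom x $ None = 1" "hom x $ Some j = x $ j"
  by (simp_all add: hom_def)

lemma dehom_hom: "dehom (c *\<^sub>R hom x) = x" if "c \<noteq> 0"
  using that by (simp add: dehom_def vec_eq_iff)

lemma hom_dehom: "y $ None \<noteq> 0 \<Longrightarrow> y = y $ None *\<^sub>R hom (dehom y)"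
  by (auto simp: vec_eq_iff dehom_def hom_def split: option.split)

lemma mult_col_shear:
  "(A ** col_shear c) $ p $ q = (case q of None \<Rightarrow> (A *v hom c) $ p | Some k \<Rightarrow> A $ p $ Some k)"
  by (auto simp: col_shear_def matrix_matrix_mult_def matrix_vector_mult_def sum_UNIV_option of_bool_def
     if_distrib[of "\<lambda>z. _ * z"] split: option.split cong: if_cong)

text \<open>
  Subtracting the first row \<open>(1, x None)\<close> from all others leaves a bordered matrix whose corner has the
  edge vectors of the simplex as rows.
\<close>

lemma det_hom:
  fixes x :: "'n::finite option \<Rightarrow> real^'n"
  shows "det (\<chi> i. hom (x i)) = fact CARD('n) * oriented_volume x"
proof -
  let ?A = "\<chi> i. hom (x i)"
  let ?B = "col_shear (\<chi> j. -1) ** ?A"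
  have "det ?A = det ?B" by (simp add: det_mul det_col_shear)
  also have "\<dots> = ?B $ None $ None * det (\<chi> j k. ?B $ Some j $ Some k)"
    by (rule det_corner) (simp add: col_shear_mult)
  also have "\<dots> = det (\<chi> i. x (Some i) - x None)"
    by (simp add: col_shear_mult) (rule arg_cong[where f=det], simp add: vec_eq_iff)
  finally show ?thesis by (simp add: oriented_volume_def)
qed

lemma scaleR_matrix_det:
  fixes A :: "real^'n::finite^'n"
  shows "det (c *\<^sub>R A) = c ^ CARD('n) * det A"
  using det_rows_mul[of "\<lambda>_. c" "\<lambda>i. A $ i"]
  by (simp add: scaleR_vec_def vector_scalar_mult_def)

definition hom_deriv :: "real^'n::finite \<Rightarrow> real^'n option" where
  "hom_deriv v = (\<chi> q. case q of None \<Rightarrow> 0 | Some j \<Rightarrow> v $ j)"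

definition proj_deriv :: "real^'n::finite option^'n option \<Rightarrow> real^'n \<Rightarrow> real^'n \<Rightarrow> real^'n" where
  "proj_deriv B x v = (\<chi> j. (B *v hom_deriv v) $ Some j / (B *v hom x) $ None
      - (B *v hom x) $ Some j * (B *v hom_deriv v) $ None / ((B *v hom x) $ None)\<^sup>2)"

lemma linear_hom_deriv: "linear hom_deriv"
  by (rule linearI) (auto simp: hom_deriv_def vec_eq_iff split: option.split)

lemma hom_eq_hom_deriv: "hom x = axis None 1 + hom_deriv x"
  by (auto simp: hom_deriv_def hom_def axis_def vec_eq_iff split: option.split)

lemma has_derivative_hom: "(hom has_derivative hom_deriv) F"
proof -
  have "((\<lambda>x. axis None 1 + hom_deriv x) has_derivative (\<lambda>v. 0 + hom_deriv v)) F"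
    by (intro has_derivative_add has_derivative_const linear_imp_has_derivative linear_hom_deriv)
  then show ?thesis by (simp add: hom_eq_hom_deriv[abs_def])
qed

lemma has_derivative_proj:
  assumes "(B *v hom x) $ None \<noteq> 0"
  shows "((\<lambda>x. dehom (B *v hom x)) has_derivative proj_deriv B x) (at x)"
proof -
  have d: "((\<lambda>x. (B *v hom x) $ q) has_derivative (\<lambda>v. (B *v hom_deriv v) $ q)) (at x)" for q
    by (intro bounded_linear.has_derivative[OF bounded_linear_vec_nth]
       bounded_linear.has_derivative[OF matrix_vector_mul_bounded_linear] has_derivative_hom)
  have "((\<lambda>x. dehom (B *v hom x) $ j) has_derivative (\<lambda>v. proj_deriv B x v $ j)) (at x)" for j
    unfolding dehom_def proj_deriv_def vec_lambda_beta
    by (rule has_derivative_eq_rhs, rule has_derivative_divide[OF d d])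
      (use assms in \<open>auto simp: field_simps power2_eq_square\<close>)
  then show ?thesis
    by (subst has_derivative_componentwise_within)
       (auto simp: Basis_vec_def inner_axis)
qed

text \<open>
  The Jacobian of a projective map is \<open>det B / w ^ (n + 1)\<close>, where \<open>w\<close> is the denominator. It is the
  reason why the exponent \<open>n + 1\<close> of the volume makes the form invariant. For the proof, \<open>B\<close> is
  multiplied by unipotent matrices: on the right to make its first column the image \<open>y\<close> of \<open>(1, x)\<close>,
  on the left to clear that column below \<open>w\<close>. The corner that remains is \<open>w\<close> times the derivative.
\<close>

lemma det_proj_deriv:
  fixes B :: "real^'n::finite option^'n option"
  assumes w: "(B *v hom x) $ None \<noteq> 0"
  shows "det B = ((B *v hom x) $ None) ^ (CARD('n) + 1) * det (matrix (proj_deriv B x))"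
proof -
  let ?y = "B *v hom x"
  let ?w = "?y $ None"
  let ?X = "col_shear (\<chi> j. - ?y $ Some j / ?w) ** (B ** col_shear x)"
  have ax: "B *v hom_deriv (axis k 1) = column (Some k) B" for k
    by (auto simp: matrix_vector_mult_def hom_deriv_def column_def vec_eq_iff sum_UNIV_option axis_def
       if_distrib[of "\<lambda>z. _ * z"] cong: if_cong)
  have "det B = det ?X" by (simp add: det_mul det_col_shear)
  also have "\<dots> = ?X $ None $ None * det (\<chi> j k. ?X $ Some j $ Some k)"
    using w by (intro det_corner) (simp add: col_shear_mult mult_col_shear)
  also have "?X $ None $ None = ?w"
    by (simp add: col_shear_mult mult_col_shear)
  also have "(\<chi> j k. ?X $ Some j $ Some k) = ?w *\<^sub>R matrix (proj_deriv B x)"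
    using w by (simp add: vec_eq_iff col_shear_mult mult_col_shear matrix_def proj_deriv_def ax column_def
       field_simps power2_eq_square)
  also have "det \<dots> = ?w ^ CARD('n) * det (matrix (proj_deriv B x))"
    by (simp add: scaleR_matrix_det)
  finally show ?thesis by simp
qed

section \<open>Change of variables over an arbitrary finite index type\<close>

text \<open>
  The change of variables theorem for integrals speaks of coordinates indexed by a well-ordered type.
  A copy of a finite type, ordered along an arbitrary enumeration, is of this kind, and relabelling the
  coordinates affects neither Lebesgue measure nor determinants. This carries the theorem over to every
  finite index type, in particular to the index type \<open>'n \<times> 'n option\<close> of the charts.
\<close>

typedef 'a ordered_copy = "UNIV :: 'a set" morphisms of_copy to_copy by simp

lemma of_to_copy [simp]: "of_copy (to_copy x) = x" by (simp add: to_copy_inverse)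

lemma bij_to_copy: "bij to_copy"
  by (rule o_bij[of of_copy]) (auto simp: fun_eq_iff of_copy_inverse)

instance ordered_copy :: (finite) finite
proof
  show "finite (UNIV :: 'a ordered_copy set)"
    using bij_to_copy by (metis bij_is_surj finite finite_imageI)
qed

definition copy_rank :: "'a::finite ordered_copy \<Rightarrow> nat" where
  "copy_rank x = (SOME h :: 'a \<Rightarrow> nat. inj h) (of_copy x)"

lemma inj_copy_rank: "inj copy_rank"
proof -
  have "\<exists>h :: 'a \<Rightarrow> nat. inj h"
    using finite_imp_inj_to_nat_seg[OF finite_class.finite_UNIV] by (elim exE conjE) (rule exI)
  then have "inj (SOME h :: 'a \<Rightarrow> nat. inj h)" by (rule someI_ex)
  then show ?thesis
    unfolding inj_def copy_rank_def of_copy_inject[symmetric] by blast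
qed

instantiation ordered_copy :: (finite) wellorder
begin

definition "less_eq_ordered_copy x y \<longleftrightarrow> copy_rank x \<le> copy_rank y" for x y :: "'a ordered_copy"
definition "less_ordered_copy x y \<longleftrightarrow> copy_rank x < copy_rank y" for x y :: "'a ordered_copy"

instance
proof
  fix P :: "'a ordered_copy \<Rightarrow> bool" and a :: "'a ordered_copy"
  assume step: "\<And>x. (\<And>y. y < x \<Longrightarrow> P y) \<Longrightarrow> P x"
  show "P a"
  proof (induction a rule: measure_induct_rule[of copy_rank])
    case (less x)
    show ?case by (rule step, rule less, simp only: less_ordered_copy_def)
  qed
next
  fix x y :: "'a ordered_copy"
  assume "x \<le> y" "y \<le> x"
  then show "x = y"
    by (intro injD[OF inj_copy_rank]) (auto simp: less_eq_ordered_copy_def)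
qed (auto simp: less_eq_ordered_copy_def less_ordered_copy_def)

end

definition from_copy :: "real^'d::finite ordered_copy \<Rightarrow> real^'d" where
  "from_copy y = (\<chi> q. y $ to_copy q)"

definition into_copy :: "real^'d::finite \<Rightarrow> real^'d ordered_copy" where
  "into_copy x = (\<chi> k. x $ of_copy k)"

lemma from_into_copy [simp]: "from_copy (into_copy x) = x" "into_copy (from_copy y) = y"
  by (simp_all add: from_copy_def into_copy_def vec_eq_iff of_copy_inverse)

lemma linear_copy: "linear from_copy" "linear into_copy"
  by (auto intro!: linearI simp: from_copy_def into_copy_def vec_eq_iff)

lemma prod_Basis_vec:
  fixes f :: "real^'d::finite \<Rightarrow> real"
  shows "prod f Basis = (\<Prod>i\<in>UNIV. f (axis i 1))"
proof -
  have "(Basis :: (real^'d) set) = range (\<lambda>i. axis i 1)" by (auto simp: Basis_vec_def)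
  moreover have "inj (\<lambda>i::'d. axis i (1::real))" by (auto simp: inj_on_def axis_eq_axis)
  ultimately have "prod f Basis = prod (f \<circ> (\<lambda>i. axis i 1)) UNIV" by (metis prod.reindex)
  then show ?thesis by (simp add: o_def)
qed

lemma borel_measurable_linear:
  fixes f :: "'a::euclidean_space \<Rightarrow> 'b::real_normed_vector"
  shows "linear f \<Longrightarrow> f \<in> borel_measurable borel"
  by (intro borel_measurable_continuous_onI linear_continuous_on linear_conv_bounded_linear[THEN iffD1])

lemma lborel_from_copy: "distr lborel borel from_copy = (lborel :: (real^'d::finite) measure)"
proof (rule lborel_eqI[symmetric])
  fix l u :: "real^'d"
  assume le: "\<And>b. b \<in> Basis \<Longrightarrow> l \<bullet> b \<le> u \<bullet> b"
  then have le': "l $ i \<le> u $ i" for i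
    using le[of "axis i 1"] by (auto simp: Basis_vec_def inner_axis)
  have "from_copy -` box l u = box (into_copy l) (into_copy u)"
  proof -
    have "(\<forall>i. l $ i < x $ to_copy i \<and> x $ to_copy i < u $ i) \<longleftrightarrow>
      (\<forall>k. l $ of_copy k < x $ k \<and> x $ k < u $ of_copy k)" for x
      by (metis of_copy_inverse of_to_copy)
    then show ?thesis by (auto simp: mem_box_cart from_copy_def into_copy_def)
  qed
  then have "emeasure (distr lborel borel from_copy) (box l u) = emeasure lborel (box (into_copy l) (into_copy u))"
    by (simp add: emeasure_distr borel_measurable_linear linear_copy)
  also have "\<dots> = (\<Prod>b\<in>Basis. (into_copy u - into_copy l) \<bullet> b)"
    using le' by (intro emeasure_lborel_box) (auto simp: inner_axis into_copy_def Basis_vec_def)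
  also have "(\<Prod>b\<in>Basis. (into_copy u - into_copy l) \<bullet> b) = (\<Prod>k\<in>UNIV. u $ of_copy k - l $ of_copy k)"
    unfolding prod_Basis_vec by (simp add: inner_axis into_copy_def)
  also have "(\<Prod>k\<in>UNIV. u $ of_copy k - l $ of_copy k) = (\<Prod>i\<in>UNIV. u $ i - l $ i)"
    by (rule prod.reindex_bij_betw[of to_copy, symmetric, THEN trans]) (auto simp: bij_to_copy)
  finally show "emeasure (distr lborel borel from_copy) (box l u) = ennreal (\<Prod>b\<in>Basis. (u - l) \<bullet> b)"
    by (simp add: prod_Basis_vec inner_axis)
qed simp

lemma has_integral_change_of_variables_nonneg:
  fixes f :: "real^'m::{finite,wellorder} \<Rightarrow> real" and g :: "real^'m::_ \<Rightarrow> real^'m::_"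
  assumes "S \<in> sets lebesgue" "\<And>x. x \<in> S \<Longrightarrow> (g has_derivative g' x) (at x within S)" "inj_on g S"
    and f: "\<And>x. 0 \<le> f x"
  shows "((\<lambda>x. \<bar>det (matrix (g' x))\<bar> * f (g x)) has_integral b) S \<longleftrightarrow> (f has_integral b) (g ` S)"
proof -
  have 1: "(\<lambda>x. \<bar>det (matrix (g' x))\<bar> * f (g x)) absolutely_integrable_on S \<longleftrightarrow>
     (\<lambda>x. \<bar>det (matrix (g' x))\<bar> * f (g x)) integrable_on S"
    using f by (intro absolutely_integrable_on_iff_nonneg) auto
  have 2: "f absolutely_integrable_on (g ` S) \<longleftrightarrow> f integrable_on (g ` S)"
    using f by (intro absolutely_integrable_on_iff_nonneg) auto
  have "(\<lambda>x. \<bar>det (matrix (g' x))\<bar> * f (g x)) absolutely_integrable_on S \<and>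
      integral S (\<lambda>x. \<bar>det (matrix (g' x))\<bar> * f (g x)) = b
     \<longleftrightarrow> f absolutely_integrable_on (g ` S) \<and> integral (g ` S) f = b"
    using has_absolute_integral_change_of_variables [OF assms(1-3), of "\<lambda>x. vec (f x) :: real^1" "vec b"]
    unfolding absolutely_integrable_on_1_iff integral_on_1_eq
    by (auto simp: vec_eq_iff)
  then show ?thesis unfolding 1 2 by (auto simp: has_integral_iff)
qed

text \<open>
  A bridge from the gauge integral, which only knows finite values, to the nonnegative integral: if one of
  the two is finite, the hypothesis makes the other one finite and equal.
\<close>

lemma nn_integral_eq_if_same_integrals:
  fixes f h :: "'a::euclidean_space \<Rightarrow> real"
  assumes [measurable]: "f \<in> borel_measurable borel" "h \<in> borel_measurable borel"
    and pos: "\<And>x. 0 \<le> f x" "\<And>x. 0 \<le> h x"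
    and same: "\<And>b. (f has_integral b) UNIV \<longleftrightarrow> (h has_integral b) UNIV"
  shows "(\<integral>\<^sup>+x. ennreal (f x) \<partial>lborel) = (\<integral>\<^sup>+x. ennreal (h x) \<partial>lborel)"
proof -
  have fin: "(\<integral>\<^sup>+x. ennreal (q x) \<partial>lborel) = (\<integral>\<^sup>+x. ennreal (p x) \<partial>lborel)"
    if pq: "p \<in> borel_measurable borel" "q \<in> borel_measurable borel" "\<And>x. 0 \<le> p x" "\<And>x. 0 \<le> q x"
      "(\<integral>\<^sup>+x. ennreal (p x) \<partial>lborel) \<noteq> \<infinity>" "\<And>b. (p has_integral b) UNIV \<longleftrightarrow> (q has_integral b) UNIV"
    for p q :: "'a \<Rightarrow> real"
  proof -
    obtain r where r: "0 \<le> r" "(\<integral>\<^sup>+x. ennreal (p x) \<partial>lborel) = ennreal r"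
      using pq(5) unfolding infinity_ennreal_def by (cases "\<integral>\<^sup>+x. ennreal (p x) \<partial>lborel") blast+
    then have "(q has_integral r) UNIV"
      using nn_integral_has_integral[OF pq(1,3) r(2,1)] pq(6) by blast
    from nn_integral_has_integral_lborel[OF pq(2,4) this] show ?thesis unfolding r(2) .
  qed
  show ?thesis
  proof (cases "(\<integral>\<^sup>+x. ennreal (f x) \<partial>lborel) = \<infinity>")
    case f: True
    show ?thesis
    proof (cases "(\<integral>\<^sup>+x. ennreal (h x) \<partial>lborel) = \<infinity>")
      case True
      then show ?thesis unfolding f ..
    next
      case False
      show ?thesis by (rule fin[OF assms(2,1) pos(2,1) False same[symmetric]])
    qed
  next
    case False
    show ?thesis by (rule fin[OF assms(1-4) False same, symmetric])
  qed
qed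

lemma det_matrix_copy:
  fixes g :: "real^'a::finite \<Rightarrow> real^'a"
  assumes "linear g"
  shows "det (matrix (into_copy \<circ> g \<circ> from_copy)) = det (matrix g)"
proof -
  have surj: "k \<in> range to_copy" for k :: "'a ordered_copy"
    using bij_is_surj[OF bij_to_copy] by blast
  have inv: "inv to_copy k = of_copy k" for k :: "'a ordered_copy"
    by (metis bij_to_copy bij_is_inj inv_f_f of_copy_inverse)
  have ax: "from_copy (axis k 1) = axis (of_copy k) 1" for k
    by (auto simp: from_copy_def axis_def vec_eq_iff of_copy_inverse)
  have "matrix (into_copy \<circ> g \<circ> from_copy) = embed_block to_copy (matrix g)"
    using surj
    by (simp add: vec_eq_iff matrix_def embed_block_def inv ax) (simp add: into_copy_def)
  then show ?thesis by (simp add: det_embed_block bij_is_inj[OF bij_to_copy])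
qed

theorem nn_integral_change_of_variables:
  fixes g :: "real^'d::finite \<Rightarrow> real^'d" and f :: "real^'d \<Rightarrow> real"
  assumes S[measurable]: "S \<in> sets borel"
    and der: "\<And>x. x \<in> S \<Longrightarrow> (g has_derivative g' x) (at x within S)"
    and inj: "inj_on g S"
    and f: "\<And>x. 0 \<le> f x"
    and m1[measurable]: "(\<lambda>x. indicator (g ` S) x * f x) \<in> borel_measurable borel"
    and m2[measurable]: "(\<lambda>x. indicator S x * (\<bar>det (matrix (g' x))\<bar> * f (g x))) \<in> borel_measurable borel"
  shows "(\<integral>\<^sup>+x. ennreal (indicator (g ` S) x * f x) \<partial>lborel)
     = (\<integral>\<^sup>+x. ennreal (indicator S x * (\<bar>det (matrix (g' x))\<bar> * f (g x))) \<partial>lborel)"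
proof -
  have mfc[measurable]: "from_copy \<in> borel_measurable borel" by (rule borel_measurable_linear[OF linear_copy(1)])
  have tr: "(\<integral>\<^sup>+x. ennreal (h x) \<partial>lborel) = (\<integral>\<^sup>+y. ennreal (h (from_copy y)) \<partial>lborel)"
    if [measurable]: "h \<in> borel_measurable borel" for h :: "real^'d \<Rightarrow> real"
    by (subst lborel_from_copy[symmetric]) (simp add: nn_integral_distr)
  let ?S = "into_copy ` S" and ?g = "into_copy \<circ> g \<circ> from_copy"
  have S': "?S = from_copy -` S"
  proof
    show "from_copy -` S \<subseteq> ?S" using from_into_copy(2) by (metis (no_types) image_eqI subsetI vimage_eq)
  qed auto
  have gS: "?g ` ?S = from_copy -` (g ` S)"
  proof
    show "from_copy -` (g ` S) \<subseteq> ?g ` ?S"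
    proof
      fix y assume "y \<in> from_copy -` (g ` S)"
      then obtain x where "x \<in> S" "from_copy y = g x" by auto
      then have "y = ?g (into_copy x)" using from_into_copy(2)[of y] by simp
      with \<open>x \<in> S\<close> show "y \<in> ?g ` ?S" by blast
    qed
  qed auto
  have Sb: "?S \<in> sets borel"
    unfolding S' using measurable_sets[OF mfc S] by simp
  define D where "D y = into_copy \<circ> g' (from_copy y) \<circ> from_copy" for y
  have der': "(?g has_derivative D y) (at y within ?S)" if "y \<in> ?S" for y
  proof -
    from that have "from_copy y \<in> S" by auto
    have img: "from_copy ` ?S = S" by (auto simp: image_iff)
    have "(g \<circ> from_copy has_derivative g' (from_copy y) \<circ> from_copy) (at y within ?S)"
      by (rule diff_chain_within) (use der \<open>from_copy y \<in> S\<close> img in \<open>auto intro: linear_imp_has_derivative linear_copy\<close>)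
    then have "(into_copy \<circ> (g \<circ> from_copy) has_derivative into_copy \<circ> (g' (from_copy y) \<circ> from_copy)) (at y within ?S)"
      by (rule diff_chain_within) (auto intro: linear_imp_has_derivative linear_copy)
    then show ?thesis by (simp add: D_def comp_assoc)
  qed
  have det: "det (matrix (D y)) = det (matrix (g' (from_copy y)))" if "y \<in> ?S" for y
    unfolding D_def using has_derivative_linear[OF der] that by (intro det_matrix_copy) auto
  have inj': "inj_on ?g ?S"
    using inj by (auto simp: inj_on_def) (metis from_into_copy(1))
  have cov: "((\<lambda>y. \<bar>det (matrix (D y))\<bar> * f (from_copy (?g y))) has_integral b) ?S
     \<longleftrightarrow> ((\<lambda>y. f (from_copy y)) has_integral b) (?g ` ?S)" for b
    by (rule has_integral_change_of_variables_nonneg[OF _ der' inj' f]) (use Sb in auto)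
  have 1: "indicator (g ` S) (from_copy y) * f (from_copy y) = (if y \<in> ?g ` ?S then f (from_copy y) else 0)" for y
    by (simp only: gS vimage_eq indicator_def) simp
  have 2: "indicator S (from_copy y) * (\<bar>det (matrix (g' (from_copy y)))\<bar> * f (g (from_copy y)))
     = (if y \<in> ?S then \<bar>det (matrix (D y))\<bar> * f (from_copy (?g y)) else 0)" for y
    using det by (auto simp: S')
  have same: "((\<lambda>y. indicator (g ` S) (from_copy y) * f (from_copy y)) has_integral b) UNIV \<longleftrightarrow>
    ((\<lambda>y. indicator S (from_copy y) * (\<bar>det (matrix (g' (from_copy y)))\<bar> * f (g (from_copy y)))) has_integral b) UNIV" for b
    unfolding 1 2 has_integral_restrict_UNIV cov ..
  have "(\<integral>\<^sup>+y. ennreal (indicator (g ` S) (from_copy y) * f (from_copy y)) \<partial>lborel)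
     = (\<integral>\<^sup>+y. ennreal (indicator S (from_copy y) * (\<bar>det (matrix (g' (from_copy y)))\<bar> * f (g (from_copy y)))) \<partial>lborel)"
  proof (rule nn_integral_eq_if_same_integrals)
    show "(\<lambda>y. indicator (g ` S) (from_copy y) * f (from_copy y)) \<in> borel_measurable borel"
      using measurable_compose[OF mfc m1] .
    show "(\<lambda>y. indicator S (from_copy y) * (\<bar>det (matrix (g' (from_copy y)))\<bar> * f (g (from_copy y)))) \<in> borel_measurable borel"
      using measurable_compose[OF mfc m2] .
  qed (use f same in auto)
  then show ?thesis by (simp only: tr[OF m1] tr[OF m2])
qed

section \<open>Smoothness of rational functions\<close>

text \<open>
  A syntactic class of smooth functions, large enough for the coefficients of the Moebius form. It is
  closed under directional derivatives, which is all that smoothness needs.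
\<close>

inductive rational_on :: "'a::real_normed_vector set \<Rightarrow> ('a \<Rightarrow> real) \<Rightarrow> bool" for S where
  const: "rational_on S (\<lambda>x. c)"
| lin: "bounded_linear f \<Longrightarrow> rational_on S f"
| add: "rational_on S f \<Longrightarrow> rational_on S g \<Longrightarrow> rational_on S (\<lambda>x. f x + g x)"
| mult: "rational_on S f \<Longrightarrow> rational_on S g \<Longrightarrow> rational_on S (\<lambda>x. f x * g x)"
| inverse: "rational_on S f \<Longrightarrow> (\<And>x. x \<in> S \<Longrightarrow> f x \<noteq> 0) \<Longrightarrow> rational_on S (\<lambda>x. inverse (f x))"

lemma rational_on_derivative:
  assumes "rational_on S f"
  shows "\<exists>f'. (\<forall>x\<in>S. (f has_derivative f' x) (at x)) \<and> (\<forall>v. rational_on S (\<lambda>x. f' x v))"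
  using assms
proof induction
  case (const c)
  show ?case by (intro exI[of _ "\<lambda>x v. 0"]) (auto intro: rational_on.const)
next
  case (lin f)
  then show ?case by (intro exI[of _ "\<lambda>x. f"]) (auto intro: rational_on.const bounded_linear_imp_has_derivative)
next
  case (add f g)
  then obtain f' g' where "\<forall>x\<in>S. (f has_derivative f' x) (at x)" "\<forall>v. rational_on S (\<lambda>x. f' x v)"
     "\<forall>x\<in>S. (g has_derivative g' x) (at x)" "\<forall>v. rational_on S (\<lambda>x. g' x v)" by blast
  then show ?case
    by (intro exI[of _ "\<lambda>x v. f' x v + g' x v"]) (auto intro: rational_on.add has_derivative_add)
next
  case (mult f g)
  then obtain f' g' where "\<forall>x\<in>S. (f has_derivative f' x) (at x)" "\<forall>v. rational_on S (\<lambda>x. f' x v)"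
     "\<forall>x\<in>S. (g has_derivative g' x) (at x)" "\<forall>v. rational_on S (\<lambda>x. g' x v)" by blast
  with mult show ?case
    by (intro exI[of _ "\<lambda>x v. f x * g' x v + f' x v * g x"])
       (auto intro!: rational_on.add rational_on.mult has_derivative_mult)
next
  case (inverse f)
  then obtain f' where f': "\<forall>x\<in>S. (f has_derivative f' x) (at x)" "\<forall>v. rational_on S (\<lambda>x. f' x v)"
    by blast
  show ?case
  proof (intro exI conjI ballI allI)
    show "rational_on S (\<lambda>x. (-1) * (inverse (f x) * f' x v * inverse (f x)))" for v
      using inverse f' by (intro rational_on.mult rational_on.const rational_on.inverse) auto
    show "((\<lambda>x. inverse (f x)) has_derivative (\<lambda>v. (-1) * (inverse (f x) * f' x v * inverse (f x)))) (at x)"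
      if "x \<in> S" for x
      using inverse f' that by (auto intro!: derivative_eq_intros)
  qed
qed

lemma Ck_on_cong:
  assumes "open S" "\<And>x. x \<in> S \<Longrightarrow> f x = g x" "Ck_on k f S"
  shows "Ck_on k g S"
  using assms(2,3)
proof (induction k arbitrary: f g)
  case 0
  then show ?case by (simp cong: continuous_on_cong)
next
  case (Suc k)
  have eq: "(f has_derivative d) (at x) \<longleftrightarrow> (g has_derivative d) (at x)" if "x \<in> S" for x d
    using that Suc.prems(1) \<open>open S\<close>
    by (auto intro: has_derivative_transform_within_open[of _ _ x UNIV S])
  then have "frechet_derivative f (at x) = frechet_derivative g (at x)" if "x \<in> S" for x
    using that by (simp add: frechet_derivative_def)
  moreover have "g differentiable (at x)" if "x \<in> S" for x
    using eq[OF that] Suc.prems(2) that unfolding differentiable_def Ck_on.simps by blast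
  ultimately show ?case
    using Suc.prems(2) by (auto intro: Suc.IH[where f="\<lambda>x. frechet_derivative f (at x) v" for v])
qed

lemma rational_on_imp_smooth_on:
  assumes "open S" "rational_on S f"
  shows "smooth_on S f"
proof -
  have "Ck_on k f S" for k
    using assms(2)
  proof (induction k arbitrary: f)
    case 0
    then obtain f' where "\<forall>x\<in>S. (f has_derivative f' x) (at x)" using rational_on_derivative by blast
    then show ?case
      by (auto intro!: continuous_at_imp_continuous_on has_derivative_continuous)
  next
    case (Suc k)
    then obtain f' where f': "\<forall>x\<in>S. (f has_derivative f' x) (at x)" "\<forall>v. rational_on S (\<lambda>x. f' x v)"
      using rational_on_derivative by blast
    have "Ck_on k (\<lambda>x. frechet_derivative f (at x) v) S" for v
    proof (rule Ck_on_cong[OF \<open>open S\<close>])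
      show "f' x v = frechet_derivative f (at x) v" if "x \<in> S" for x
        using f'(1) that frechet_derivative_at by metis
    qed (use f'(2) Suc.IH in auto)
    moreover have "\<forall>x\<in>S. f differentiable (at x)"
      unfolding differentiable_def using f'(1) by blast
    ultimately show ?case by simp
  qed
  then show ?thesis by (simp add: smooth_on_def)
qed

lemma rational_on_sum: "finite I \<Longrightarrow> (\<And>i. i \<in> I \<Longrightarrow> rational_on S (f i)) \<Longrightarrow> rational_on S (\<lambda>x. \<Sum>i\<in>I. f i x)"
  by (induction I rule: finite_induct) (auto intro: rational_on.intros)

lemma rational_on_prod: "finite I \<Longrightarrow> (\<And>i. i \<in> I \<Longrightarrow> rational_on S (f i)) \<Longrightarrow> rational_on S (\<lambda>x. \<Prod>i\<in>I. f i x)"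
  by (induction I rule: finite_induct) (auto intro: rational_on.intros)

lemma rational_on_power: "rational_on S f \<Longrightarrow> rational_on S (\<lambda>x. f x ^ n)"
  by (induction n) (auto intro: rational_on.intros)

lemma rational_on_det: "(\<And>i j. rational_on S (\<lambda>x. A x $ i $ j)) \<Longrightarrow> rational_on S (\<lambda>x. det (A x))"
  unfolding det_def by (intro rational_on_sum rational_on.mult rational_on_prod rational_on.const) auto

section \<open>The coordinate volume form\<close>

lemma alternating_multilinear_wedge_dx: "alternating_multilinear (\<lambda>v. c * wedge dx v)"
proof -
  have w: "wedge dx v = det (\<chi> k. v k)" for v :: "'d \<Rightarrow> real^'d"
    unfolding wedge_def dx_def by (rule arg_cong[where f=det]) (simp add: vec_eq_iff)
  have upd: "(\<chi> j. (v(k := y)) j) = (\<chi> j. if j = k then y else v j)" for v :: "'d \<Rightarrow> real^'d" and k y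
    by (simp add: vec_eq_iff)
  have "linear (\<lambda>y. c * wedge dx (v(k := y)))" for v :: "'d \<Rightarrow> real^'d" and k
    unfolding w upd
    by (rule linearI)
      (simp_all add: det_row_add det_row_mul[of k _ "\<lambda>_. _" v, unfolded scalar_mult_eq_scaleR] algebra_simps)
  moreover have "c * wedge dx v = 0" if "k \<noteq> l" "v k = v l" for v :: "'d \<Rightarrow> real^'d" and k l
    unfolding w using that det_identical_rows[of k l "\<chi> k. v k"] by (simp add: row_def vec_eq_iff)
  ultimately show ?thesis unfolding alternating_multilinear_def by blast
qed

lemma wedge_dx_linear:
  assumes "linear D"
  shows "wedge dx (\<lambda>k. D (v k)) = det (matrix D) * wedge dx v"
proof -
  have "(\<chi> k l. dx l (D (v k))) = (\<chi> k l. dx l (v k)) ** Finite_Cartesian_Product.transpose (matrix D)"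
  proof -
    have "D (v k) $ l = (matrix D *v v k) $ l" for k l by (simp add: matrix_works assms)
    then show ?thesis
      by (simp add: vec_eq_iff dx_def matrix_matrix_mult_def matrix_vector_mult_def
        Finite_Cartesian_Product.transpose_def mult.commute)
  qed
  then show ?thesis by (simp add: wedge_def det_mul det_transpose)
qed

lemma wedge_dx_axis: "wedge dx (\<lambda>k::'d::finite. axis k 1) = 1"
proof -
  have "(\<chi> k l. dx l (axis k 1)) = (mat 1 :: real^'d^'d)"
    by (auto simp: dx_def axis_def mat_def vec_eq_iff)
  then show ?thesis unfolding wedge_def by (simp only: det_I)
qed

section \<open>Lines, hyperplanes and frames\<close>

definition line_of :: "real^'m::finite \<Rightarrow> 'm proj" where
  "line_of v = Proj (span {v})"

lemma line_set_line_of: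
  assumes "v \<noteq> 0"
  shows "line_set (line_of v) = span {v}"
proof -
  have "dim (span {v}) = 1"
    using assms by (simp add: dim_span_eq_card_independent)
  then show ?thesis unfolding line_of_def by (intro Proj_inverse) simp
qed

lemma line_of_cases:
  obtains v where "v \<noteq> 0" "L = line_of v"
proof -
  have L: "subspace (line_set L)" "dim (line_set L) = 1" using line_set[of L] by auto
  then obtain B where B: "B \<subseteq> line_set L" "independent B" "line_set L \<subseteq> span B" "card B = 1"
    by (metis basis_exists)
  then obtain v where v: "B = {v}" by (meson card_1_singletonE)
  with B have "v \<noteq> 0" by (metis dependent_zero singletonI)
  moreover have "line_set L = span {v}"
    using B v L by (metis span_minimal subset_antisym)
  ultimately show ?thesis
    using that unfolding line_of_def by (metis line_set_inverse)
qed

lemma line_of_eq_iff: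
  assumes "v \<noteq> 0" "w \<noteq> 0"
  shows "line_of v = line_of w \<longleftrightarrow> (\<exists>t. t \<noteq> 0 \<and> v = t *\<^sub>R w)"
proof
  assume "line_of v = line_of w"
  then have "span {v} = span {w}" using assms by (metis line_set_line_of)
  then have "v \<in> span {w}" by (metis span_base singletonI)
  then obtain t where "v = t *\<^sub>R w" by (auto simp: span_singleton)
  with assms show "\<exists>t. t \<noteq> 0 \<and> v = t *\<^sub>R w" by auto
next
  assume "\<exists>t. t \<noteq> 0 \<and> v = t *\<^sub>R w"
  then obtain t where "t \<noteq> 0" "v = t *\<^sub>R w" by blast
  then have "v \<in> span {w}" "w = inverse t *\<^sub>R v"
    by (simp_all add: span_mul span_base)
  moreover from this have "w \<in> span {v}" by (metis span_base span_mul singletonI)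
  ultimately have "span {v} = span {w}" by (simp add: span_eq)
  then show "line_of v = line_of w" by (simp add: line_of_def)
qed

lemma continuous_on_line_of: "continuous_on {v. v \<noteq> 0} line_of"
proof -
  have "open {v :: real^'a. v \<noteq> 0}" by (simp add: open_Collect_neq)
  moreover have "open (line_of -` B \<inter> {v. v \<noteq> 0})" if "open B" for B :: "'a proj set"
  proof -
    have "line_of -` B \<inter> {v. v \<noteq> 0} = {x. x \<noteq> 0 \<and> Proj (span {x}) \<in> B}" by (auto simp: line_of_def)
    then show ?thesis using that by (simp add: open_proj_def)
  qed
  ultimately show ?thesis by (simp add: continuous_on_open_vimage)
qed

text \<open>
  A common hyperplane of the lines is a nonzero vector in the kernel of the matrix of spanning vectors.
\<close>

lemma frame_in_FCF_iff:
  fixes v :: "'n::finite option \<Rightarrow> real^'n option"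
  assumes "\<And>i. v i \<noteq> 0"
  shows "(\<chi> i. line_of (v i)) \<in> FCF \<longleftrightarrow> det (\<chi> i. v i) \<noteq> 0"
proof -
  have sp: "span {v i} \<subseteq> {x. a \<bullet> x = 0} \<longleftrightarrow> ((\<chi> i. v i) *v a) $ i = 0" for a i
  proof
    assume "span {v i} \<subseteq> {x. a \<bullet> x = 0}"
    then have "v i \<in> {x. a \<bullet> x = 0}" by (metis span_base singletonI subsetD)
    then show "((\<chi> i. v i) *v a) $ i = 0" by (simp add: matrix_vector_mul_component inner_commute)
  qed (auto simp: span_singleton matrix_vector_mul_component inner_commute)
  have L: "line_set ((\<chi> i. line_of (v i)) $ i) = span {v i}" for i
    by (simp add: line_set_line_of assms)
  have "(\<chi> i. line_of (v i)) \<in> FCF \<longleftrightarrow> (\<forall>a. (\<forall>i. ((\<chi> i. v i) *v a) $ i = 0) \<longrightarrow> a = 0)"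
    unfolding FCF_def mem_Collect_eq L sp by blast
  also have "\<dots> \<longleftrightarrow> (\<forall>a. (\<chi> i. v i) *v a = 0 \<longrightarrow> a = 0)"
    by (simp only: vec_eq_iff zero_index)
  also have "\<dots> \<longleftrightarrow> det (\<chi> i. v i) \<noteq> 0"
    by (simp add: matrix_left_invertible_ker[symmetric] invertible_left_inverse[symmetric] invertible_det_nz)
  finally show ?thesis .
qed

text \<open>
  The columns of \<^term>\<open>N\<close> are a base point of the hyperplane and the images of the coordinate vectors, so
  that \<open>x \<mapsto> N *v hom x\<close> is the inverse of the coordinate system \<open>e\<close>. With this, a
  hyperplane with coordinates is handled through one invertible matrix and the standard affine chart.
\<close>

definition affine_frame :: "(real^'n::finite option) set \<Rightarrow> (real^'n option \<Rightarrow> real^'n) \<Rightarrow> real^'n option^'n option \<Rightarrow> bool" where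
  "affine_frame P e N \<longleftrightarrow> invertible N \<and> P = range (\<lambda>x. N *v hom x) \<and> (\<forall>x. e (N *v hom x) = x)"

text \<open>
  After subtracting its value at the origin, an isometry preserves norms and distances, hence inner
  products by polarisation; then the defects of additivity and homogeneity have norm zero.
\<close>

lemma isometry_imp_affine:
  fixes a :: "'a::real_inner \<Rightarrow> 'b::real_inner"
  assumes "\<And>x y. dist (a x) (a y) = dist x y"
  shows "linear (\<lambda>x. a x - a 0)" "norm (a x - a 0) = norm x"
proof -
  define T where "T x = a x - a 0" for x
  have nT: "norm (T x - T y) = norm (x - y)" for x y
    using assms[of x y] by (simp add: T_def dist_norm)
  have n: "norm (T x) = norm x" for x
    using nT[of x 0] by (simp add: T_def)
  have ip: "T x \<bullet> T y = x \<bullet> y" for x y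
  proof -
    have "(norm (T x - T y))\<^sup>2 = (norm (x - y))\<^sup>2" by (simp add: nT)
    moreover have "(norm (T x))\<^sup>2 = (norm x)\<^sup>2" "(norm (T y))\<^sup>2 = (norm y)\<^sup>2" by (simp_all add: n)
    ultimately show ?thesis
      by (simp add: power2_norm_eq_inner inner_diff_left inner_diff_right inner_commute)
  qed
  have "linear T"
  proof (rule linearI)
    fix x y
    have "(norm (T (x + y) - (T x + T y)))\<^sup>2 = 0"
      unfolding power2_norm_eq_inner
      by (simp add: inner_diff_left inner_diff_right inner_add_left inner_add_right ip)
    then show "T (x + y) = T x + T y" by simp
  next
    fix r x
    have "(norm (T (r *\<^sub>R x) - r *\<^sub>R T x))\<^sup>2 = 0"
      unfolding power2_norm_eq_inner
      by (simp add: inner_diff_left inner_diff_right ip)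
    then show "T (r *\<^sub>R x) = r *\<^sub>R T x" by simp
  qed
  then show "linear (\<lambda>x. a x - a 0)" "norm (a x - a 0) = norm x"
    using n by (simp_all add: T_def[abs_def])
qed

text \<open>
  The inverse of the coordinate system is an isometry, hence affine. The matrix is invertible because the
  linear part is injective and the hyperplane misses the origin.
\<close>

lemma euclidean_hyperplane_affine_frame:
  assumes "euclidean_hyperplane P e"
  obtains N where "affine_frame P e N"
proof -
  define a where "a = inv_into P e"
  have bij: "bij_betw e P UNIV" and iso: "\<And>x y. x \<in> P \<Longrightarrow> y \<in> P \<Longrightarrow> dist (e x) (e y) = dist x y"
    and "0 \<notin> P"
    using assms by (auto simp: euclidean_hyperplane_def)
  have aP: "a x \<in> P" "e (a x) = x" for x
    using bij by (auto simp: a_def bij_betw_def inv_into_into f_inv_into_f)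
  have rng: "P = range a"
    using bij by (metis a_def bij_betw_def bij_betw_inv_into)
  have da: "dist (a x) (a y) = dist x y" for x y
    using iso[of "a x" "a y"] aP by simp
  define T where "T x = a x - a 0" for x
  have T: "linear T" "\<And>x. norm (T x) = norm x"
    using isometry_imp_affine[of a] da unfolding T_def[abs_def] by blast+
  define N where "N = (\<chi> p q. case q of None \<Rightarrow> a 0 $ p | Some j \<Rightarrow> T (axis j 1) $ p)"
  have T_sum: "T z = (\<Sum>j\<in>UNIV. z $ j *\<^sub>R T (axis j 1))" for z
  proof -
    have "T z = T (\<Sum>j\<in>UNIV. z $ j *\<^sub>R axis j 1)"
      by (rule arg_cong[where f=T]) (simp add: vec_eq_iff axis_def if_distrib[of "\<lambda>z. _ * z"] cong: if_cong)
    then show ?thesis by (simp add: linear_sum[OF T(1)] linear_cmul[OF T(1)])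
  qed
  have Ny: "N *v y = y $ None *\<^sub>R a 0 + T (\<chi> j. y $ Some j)" for y
    by (simp add: vec_eq_iff N_def matrix_vector_mult_def sum_UNIV_option T_sum[of "\<chi> j. y $ Some j"] mult.commute)
  have Nhom: "N *v hom x = a x" for x
    by (simp add: Ny) (simp add: T_def)
  have "y = 0" if "N *v y = 0" for y
  proof -
    let ?z = "\<chi> j. y $ Some j"
    \<comment> \<open>Otherwise, after rescaling, the origin would be a point of the hyperplane.\<close>
    have "y $ None = 0"
    proof (rule ccontr)
      assume "y $ None \<noteq> 0"
      then have "N *v hom (dehom y) = 0"
        using that hom_dehom[of y] by (metis matrix_vector_mult_scaleR scaleR_eq_0_iff)
      with \<open>0 \<notin> P\<close> aP(1) show False by (metis Nhom)
    qed
    moreover from this have "T ?z = 0" using that Ny[of y] by simp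
    then have "?z = 0" using T(2)[of ?z] by simp
    then have "y $ Some j = 0" for j by (simp add: vec_eq_iff)
    ultimately show "y = 0" unfolding vec_eq_iff by (metis option.exhaust zero_index)
  qed
  then have "invertible N"
    by (simp add: invertible_left_inverse matrix_left_invertible_ker)
  then have "affine_frame P e N"
    unfolding affine_frame_def Nhom using rng aP(2) by blast
  then show ?thesis by (rule that)
qed

lemma matrix_inv_mult:
  fixes N :: "real^'m::finite^'m"
  assumes "invertible N"
  shows "N ** matrix_inv N = mat 1" "matrix_inv N ** N = mat 1"
proof -
  have "N ** matrix_inv N = mat 1 \<and> matrix_inv N ** N = mat 1"
    unfolding matrix_inv_def by (rule someI_ex) (use assms in \<open>simp add: invertible_def\<close>)
  then show "N ** matrix_inv N = mat 1" "matrix_inv N ** N = mat 1" by simp_all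
qed

lemma matrix_inv_vector:
  fixes N :: "real^'m::finite^'m"
  assumes "invertible N"
  shows "matrix_inv N *v (N *v v) = v" "N *v (matrix_inv N *v v) = v"
  using assms by (simp_all add: matrix_vector_mul_assoc matrix_inv_mult)

lemma invertible_mult_eq_0_iff:
  fixes N :: "real^'m::finite^'m"
  assumes "invertible N"
  shows "N *v v = 0 \<longleftrightarrow> v = 0"
  by (metis assms matrix_inv_vector(1) matrix_vector_mult_0_right)

lemma hom_nonzero: "hom x \<noteq> 0"
  by (metis hom_nth(1) zero_index zero_neq_one)

lemma dehom_scaleR: "c \<noteq> 0 \<Longrightarrow> dehom (c *\<^sub>R y) = dehom y"
  by (simp add: dehom_def vec_eq_iff)

lemma affine_frame_meets_iff:
  assumes "affine_frame P e N" "v \<noteq> 0"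
  shows "line_set (line_of v) \<inter> P \<noteq> {} \<longleftrightarrow> (matrix_inv N *v v) $ None \<noteq> 0"
    and "(matrix_inv N *v v) $ None \<noteq> 0 \<Longrightarrow> line_coords P e (line_of v) = dehom (matrix_inv N *v v)"
proof -
  have N: "invertible N" "P = range (\<lambda>x. N *v hom x)" "\<And>x. e (N *v hom x) = x"
    using assms(1) by (auto simp: affine_frame_def)
  define y where "y = matrix_inv N *v v"
  have v: "v = N *v y" by (simp add: y_def matrix_inv_vector N(1))
  have mem: "A \<in> line_set (line_of v) \<inter> P \<longleftrightarrow> y $ None \<noteq> 0 \<and> A = N *v hom (dehom y)" for A
  proof
    assume "A \<in> line_set (line_of v) \<inter> P"
    then have "A \<in> span {v}" "A \<in> range (\<lambda>x. N *v hom x)"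
      by (auto simp: line_set_line_of assms(2) N(2))
    then obtain t x where A: "A = t *\<^sub>R (N *v y)" "A = N *v hom x"
      unfolding span_singleton using v by blast
    then have "matrix_inv N *v (N *v hom x) = matrix_inv N *v (N *v (t *\<^sub>R y))"
      by (simp add: matrix_vector_mult_scaleR)
    then have h: "hom x = t *\<^sub>R y" by (simp add: matrix_inv_vector N(1))
    have "hom x $ None = t * y $ None" unfolding h by simp
    then have "t \<noteq> 0" "y $ None \<noteq> 0" by auto
    moreover have "x = dehom y"
      using dehom_hom[of 1 x] dehom_scaleR[OF \<open>t \<noteq> 0\<close>, of y] unfolding h by simp
    ultimately show "y $ None \<noteq> 0 \<and> A = N *v hom (dehom y)" using A by simp
  next
    assume y: "y $ None \<noteq> 0 \<and> A = N *v hom (dehom y)"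
    have "v = N *v (y $ None *\<^sub>R hom (dehom y))"
      unfolding v by (rule arg_cong[OF hom_dehom]) (use y in simp)
    then have vA: "v = y $ None *\<^sub>R A" by (simp only: matrix_vector_mult_scaleR conjunct2[OF y])
    have "inverse (y $ None) *\<^sub>R v = A" unfolding vA using conjunct1[OF y] by simp
    then have "A \<in> span {v}" by (metis span_base span_mul singletonI)
    moreover have "A \<in> P" using conjunct2[OF y] N(2) by blast
    ultimately show "A \<in> line_set (line_of v) \<inter> P" by (simp add: line_set_line_of assms(2))
  qed
  then show "line_set (line_of v) \<inter> P \<noteq> {} \<longleftrightarrow> (matrix_inv N *v v) $ None \<noteq> 0"
    unfolding y_def[symmetric] by blast
  assume "(matrix_inv N *v v) $ None \<noteq> 0"
  then have "(THE A. A \<in> line_set (line_of v) \<inter> P) = N *v hom (dehom y)"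
    unfolding mem by (simp add: y_def)
  then show "line_coords P e (line_of v) = dehom (matrix_inv N *v v)"
    unfolding line_coords_def N(3) y_def by (simp add: N(3) y_def)
qed

section \<open>The charts of the manifold of framed continued fractions\<close>

definition coords_of :: "real^('n::finite \<times> 'k::finite) \<Rightarrow> 'k \<Rightarrow> real^'n" where
  "coords_of x i = (\<chi> j. x $ (j, i))"

definition frame_vector :: "('k::finite \<Rightarrow> real^'n::finite option^'n option) \<Rightarrow> real^('n \<times> 'k) \<Rightarrow> 'k \<Rightarrow> real^'n option" where
  "frame_vector N x i = N i *v hom (coords_of x i)"

definition frame_lines :: "('k::finite \<Rightarrow> real^'n::finite option^'n option) \<Rightarrow> real^('n \<times> 'k) \<Rightarrow> 'n option proj^'k" where
  "frame_lines N x = (\<chi> i. line_of (frame_vector N x i))"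

definition frame_det :: "('n::finite option \<Rightarrow> real^'n option^'n option) \<Rightarrow> real^('n \<times> 'n option) \<Rightarrow> real" where
  "frame_det N x = det (\<chi> i. frame_vector N x i)"

definition chart_image :: "('n::finite option \<Rightarrow> real^'n option^'n option) \<Rightarrow> (real^('n \<times> 'n option)) set" where
  "chart_image N = {x. frame_det N x \<noteq> 0}"

definition line_in_chart :: "real^'n::finite option^'n option \<Rightarrow> 'n option proj \<Rightarrow> bool" where
  "line_in_chart N L \<longleftrightarrow> (\<exists>v. v \<noteq> 0 \<and> L = line_of v \<and> (matrix_inv N *v v) $ None \<noteq> 0)"

text \<open>
  Any spanning vector of the line may be chosen, since \<^const>\<open>dehom\<close> is invariant under rescaling.
\<close>

definition line_coord :: "real^'n::finite option^'n option \<Rightarrow> 'n option proj \<Rightarrow> real^'n" where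
  "line_coord N L = dehom (matrix_inv N *v (SOME v. v \<noteq> 0 \<and> L = line_of v))"

lemma line_in_chart_line_of:
  assumes "v \<noteq> 0"
  shows "line_in_chart N (line_of v) \<longleftrightarrow> (matrix_inv N *v v) $ None \<noteq> 0"
  using assms by (auto simp: line_in_chart_def line_of_eq_iff matrix_vector_mult_scaleR)

lemma line_coord_line_of:
  assumes "v \<noteq> 0"
  shows "line_coord N (line_of v) = dehom (matrix_inv N *v v)"
proof -
  define w where "w = (SOME w. w \<noteq> 0 \<and> line_of v = line_of w)"
  have "w \<noteq> 0 \<and> line_of v = line_of w"
    unfolding w_def by (rule someI[of _ v]) (simp add: assms)
  then obtain t where "t \<noteq> 0" "v = t *\<^sub>R w"
    using assms line_of_eq_iff by blast
  then show ?thesis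
    unfolding line_coord_def w_def[symmetric] by (simp add: matrix_vector_mult_scaleR dehom_scaleR)
qed

lemma open_line_in_chart: "open (Collect (line_in_chart N))"
proof -
  have "{x. x \<noteq> 0 \<and> Proj (span {x}) \<in> Collect (line_in_chart N)} = {x. (matrix_inv N *v x) $ None \<noteq> 0}"
  proof -
    have "x \<noteq> 0" if "(matrix_inv N *v x) $ None \<noteq> 0" for x using that by auto
    then show ?thesis by (auto simp: line_of_def[symmetric] line_in_chart_line_of)
  qed
  moreover have "open {x. (matrix_inv N *v x) $ None \<noteq> 0}"
    by (intro open_Collect_neq continuous_intros)
  ultimately show ?thesis by (simp add: open_proj_def)
qed

lemma continuous_on_dehom: "continuous_on {y. y $ None \<noteq> 0} dehom"
  unfolding dehom_def by (intro continuous_intros) auto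

lemma continuous_on_line_coord: "continuous_on (Collect (line_in_chart N)) (line_coord N)"
proof -
  let ?S = "{x. (matrix_inv N *v x) $ None \<noteq> 0}"
  have c: "continuous_on ?S (\<lambda>x. dehom (matrix_inv N *v x))"
    by (rule continuous_on_compose2[OF continuous_on_dehom]) (auto intro!: continuous_intros)
  have S: "open ?S" by (intro open_Collect_neq continuous_intros)
  have "open (line_coord N -` B \<inter> Collect (line_in_chart N))" if "open B" for B
  proof -
    have "{x. x \<noteq> 0 \<and> Proj (span {x}) \<in> line_coord N -` B \<inter> Collect (line_in_chart N)}
        = (\<lambda>x. dehom (matrix_inv N *v x)) -` B \<inter> ?S"
    proof -
      have "x \<noteq> 0" if "(matrix_inv N *v x) $ None \<noteq> 0" for x using that by auto
      then show ?thesis by (auto simp: line_of_def[symmetric] line_in_chart_line_of line_coord_line_of)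
    qed
    then show ?thesis using that c S by (simp add: open_proj_def continuous_on_open_vimage)
  qed
  then show ?thesis by (simp add: continuous_on_open_vimage open_line_in_chart)
qed

text \<open>
  The family \<^term>\<open>N\<close> replaces the hyperplanes and coordinate systems from which the chart was built, which
  cannot be recovered from the chart itself.
\<close>

definition chart_frame :: "('n::finite option proj^'n option, 'n \<times> 'n option) chart \<Rightarrow>
    ('n option \<Rightarrow> real^'n option^'n option) \<Rightarrow> bool" where
  "chart_frame c N \<longleftrightarrow> (\<forall>i. invertible (N i)) \<and> fst c = {l \<in> FCF. \<forall>i. line_in_chart (N i) (l $ i)} \<and>
     (\<forall>l\<in>fst c. \<forall>i j. snd c l $ (j, i) = line_coord (N i) (l $ i) $ j)"

lemma chart_frame_FCF_chart:
  assumes "\<And>i. affine_frame (P i) (e i) (N i)"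
  shows "chart_frame (FCF_chart P e) N"
proof -
  have meet: "line_set L \<inter> P i \<noteq> {} \<longleftrightarrow> line_in_chart (N i) L"
    and coord: "line_in_chart (N i) L \<Longrightarrow> line_coords (P i) (e i) L = line_coord (N i) L" for L i
    by (cases L rule: line_of_cases;
        simp add: affine_frame_meets_iff[OF assms] line_in_chart_line_of line_coord_line_of)+
  have "\<forall>i. invertible (N i)" using assms by (simp add: affine_frame_def)
  then show ?thesis
    by (auto simp: chart_frame_def FCF_chart_def meet coord)
qed

lemma frame_vector_nonzero: "invertible (N i) \<Longrightarrow> frame_vector N x i \<noteq> 0"
  by (simp add: frame_vector_def invertible_mult_eq_0_iff hom_nonzero)

context
  fixes c :: "('n::finite option proj^'n option, 'n \<times> 'n option) chart" and N
  assumes cN: "chart_frame c N"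
begin

lemma chart_frame_invertible: "invertible (N i)"
  using cN by (simp add: chart_frame_def)

lemma frame_lines_in_chart: "line_in_chart (N i) (frame_lines N x $ i)"
  "line_coord (N i) (frame_lines N x $ i) = coords_of x i"
  using frame_vector_nonzero[where N=N and x=x, OF chart_frame_invertible[of i]] dehom_hom[of 1]
  by (simp_all add: frame_lines_def line_in_chart_line_of line_coord_line_of)
    (simp_all add: frame_vector_def matrix_inv_vector chart_frame_invertible)

lemma frame_lines_in_FCF_iff: "frame_lines N x \<in> FCF \<longleftrightarrow> x \<in> chart_image N"
  unfolding frame_lines_def chart_image_def frame_det_def mem_Collect_eq
  by (rule frame_in_FCF_iff) (rule frame_vector_nonzero[OF chart_frame_invertible])

lemma frame_lines_in_domain: "x \<in> chart_image N \<Longrightarrow> frame_lines N x \<in> fst c"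
  using cN frame_lines_in_chart frame_lines_in_FCF_iff by (simp add: chart_frame_def)

lemma chart_frame_lines: "x \<in> chart_image N \<Longrightarrow> snd c (frame_lines N x) = x"
  using frame_lines_in_domain cN frame_lines_in_chart
  by (auto simp: chart_frame_def vec_eq_iff coords_of_def)

lemma chart_domain_cases:
  assumes "l \<in> fst c"
  shows "snd c l \<in> chart_image N" "l = frame_lines N (snd c l)"
proof -
  have l: "l \<in> FCF" "\<And>i. line_in_chart (N i) (l $ i)" "\<And>i j. snd c l $ (j, i) = line_coord (N i) (l $ i) $ j"
    using assms cN by (auto simp: chart_frame_def)
  have "l $ i = frame_lines N (snd c l) $ i" for i
  proof -
    obtain v where v: "v \<noteq> 0" "l $ i = line_of v" "(matrix_inv (N i) *v v) $ None \<noteq> 0"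
      using l(2)[of i] by (auto simp: line_in_chart_def)
    define y where "y = matrix_inv (N i) *v v"
    have bl: "coords_of (snd c l) i = dehom y"
      using l(3) v by (simp add: coords_of_def vec_eq_iff line_coord_line_of y_def)
    have vy: "v = y $ None *\<^sub>R (N i *v hom (dehom y))"
      using hom_dehom[of y] v(3) matrix_inv_vector(2)[OF chart_frame_invertible, of i v]
      unfolding y_def[symmetric] by (metis matrix_vector_mult_scaleR)
    have "v = y $ None *\<^sub>R frame_vector N (snd c l) i"
      unfolding frame_vector_def bl by (rule vy)
    moreover have "y $ None \<noteq> 0" using v(3) by (simp add: y_def)
    ultimately show ?thesis
      using v line_of_eq_iff[OF v(1), of "frame_vector N (snd c l) i"]
        frame_vector_nonzero[OF chart_frame_invertible] by (auto simp: frame_lines_def)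
  qed
  then show "l = frame_lines N (snd c l)" by (simp add: vec_eq_iff)
  with l(1) show "snd c l \<in> chart_image N" using frame_lines_in_FCF_iff by metis
qed

lemma chart_image_eq: "snd c ` fst c = chart_image N"
  using chart_domain_cases(1) frame_lines_in_domain chart_frame_lines
  by (metis (no_types, lifting) image_iff subsetI subset_antisym)

lemma inj_on_chart: "inj_on (snd c) (fst c)"
  by (metis chart_domain_cases(2) inj_onI)

lemma chart_inv_eq: "x \<in> chart_image N \<Longrightarrow> chart_inv c x = frame_lines N x"
  unfolding chart_inv_def
  using the_inv_into_f_f[OF inj_on_chart frame_lines_in_domain] chart_frame_lines by metis

lemma continuous_on_chart: "continuous_on (fst c) (snd c)"
proof -
  have "continuous_on (fst c) (\<lambda>l. \<chi> q. line_coord (N (snd q)) (l $ snd q) $ fst q)"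
  proof (intro continuous_on_vec_lambda continuous_on_component)
    fix q :: "'n \<times> 'n option"
    have "continuous_on (fst c) (\<lambda>l. l $ snd q)"
      by (auto simp: continuous_on_def intro!: tendsto_intros)
    then show "continuous_on (fst c) (\<lambda>l. line_coord (N (snd q)) (l $ snd q))"
      by (rule continuous_on_compose2[OF continuous_on_line_coord]) (use cN in \<open>auto simp: chart_frame_def\<close>)
  qed
  then show ?thesis
    using cN by (subst continuous_on_cong[OF refl, of _ _ "\<lambda>l. \<chi> q. line_coord (N (snd q)) (l $ snd q) $ fst q"])
      (auto simp: chart_frame_def vec_eq_iff)
qed

lemma continuous_on_frame_lines: "continuous_on S (frame_lines N)"
  unfolding frame_lines_def
proof (rule continuous_on_vec_lambda)
  fix i
  have "continuous_on S (\<lambda>x. frame_vector N x i)"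
    unfolding frame_vector_def hom_eq_hom_deriv coords_of_def
    by (intro linear_continuous_on_compose[OF _ matrix_vector_mul_linear] continuous_on_add continuous_on_const
        linear_continuous_on_compose[OF _ linear_hom_deriv] continuous_on_vec_lambda continuous_on_component continuous_on_id)
  then show "continuous_on S (\<lambda>x. line_of (frame_vector N x i))"
    by (rule continuous_on_compose2[OF continuous_on_line_of])
      (use frame_vector_nonzero[where N=N, OF chart_frame_invertible[of i]] in auto)
qed

lemma openin_chart_domain: "\<exists>T. open T \<and> fst c = FCF \<inter> T"
proof (intro exI conjI)
  have "open (\<Inter>i. (\<lambda>l. l $ i) -` Collect (line_in_chart (N i)))"
    by (intro open_INT ballI open_vimage_vec_nth open_line_in_chart) simp
  then show "open {l. \<forall>i. line_in_chart (N i) (l $ i)}"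
    by (simp add: vimage_def Inter_eq)
  show "fst c = FCF \<inter> {l. \<forall>i. line_in_chart (N i) (l $ i)}"
    using cN by (auto simp: chart_frame_def)
qed

end

section \<open>Transition maps and the invariant form\<close>

lemma linear_coords_of: "linear (\<lambda>x. coords_of x i)"
  by (rule linearI) (auto simp: coords_of_def vec_eq_iff)

lemma continuous_on_hom_coords_of: "continuous_on S (\<lambda>x. (B *v hom (coords_of x i)) $ q)"
  unfolding hom_eq_hom_deriv
  by (intro continuous_on_component linear_continuous_on_compose[OF _ matrix_vector_mul_linear] continuous_on_add continuous_on_const
        linear_continuous_on_compose[OF _ linear_hom_deriv] linear_continuous_on_compose[OF _ linear_coords_of] continuous_on_id)

lemma rational_on_hom_coords_of: "rational_on S (\<lambda>x. (B *v hom (coords_of x i)) $ q)"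
proof -
  have "linear (\<lambda>x. (B *v hom_deriv (coords_of x i)) $ q)"
    by (rule linearI) (simp_all add: linear_add[OF linear_coords_of] linear_cmul[OF linear_coords_of]
        linear_add[OF linear_hom_deriv] linear_cmul[OF linear_hom_deriv] matrix_vector_right_distrib
        matrix_vector_mult_scaleR)
  then have "rational_on S (\<lambda>x. (B *v axis None 1) $ q + (B *v hom_deriv (coords_of x i)) $ q)"
    by (intro rational_on.add rational_on.const rational_on.lin linear_conv_bounded_linear[THEN iffD1])
  then show ?thesis unfolding hom_eq_hom_deriv by (simp add: matrix_vector_right_distrib)
qed

lemma rational_on_frame_det: "rational_on S (frame_det N)"
proof -
  have "rational_on S (\<lambda>x. det (\<chi> i. frame_vector N x i))"
    by (rule rational_on_det) (simp add: frame_vector_def rational_on_hom_coords_of)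
  then show ?thesis by (simp add: frame_det_def[abs_def])
qed

lemma rational_on_continuous_on: "rational_on S f \<Longrightarrow> continuous_on S f"
  using rational_on_derivative by (blast intro: continuous_at_imp_continuous_on has_derivative_continuous)

lemma open_chart_image: "open (chart_image N)"
  unfolding chart_image_def
  by (intro open_Collect_neq rational_on_continuous_on rational_on_frame_det continuous_intros)

definition proj_map :: "('k::finite \<Rightarrow> real^'n::finite option^'n option) \<Rightarrow> real^('n \<times> 'k) \<Rightarrow> real^('n \<times> 'k)" where
  "proj_map B x = (\<chi> q. dehom (B (snd q) *v hom (coords_of x (snd q))) $ fst q)"

definition proj_map_deriv :: "('k::finite \<Rightarrow> real^'n::finite option^'n option) \<Rightarrow> real^('n \<times> 'k) \<Rightarrow> real^('n \<times> 'k) \<Rightarrow> real^('n \<times> 'k)" where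
  "proj_map_deriv B x v = (\<chi> q. proj_deriv (B (snd q)) (coords_of x (snd q)) (coords_of v (snd q)) $ fst q)"

lemma coords_of_proj_map: "coords_of (proj_map B x) i = dehom (B i *v hom (coords_of x i))"
  by (simp add: coords_of_def proj_map_def vec_eq_iff)

lemma has_derivative_proj_map:
  assumes "\<And>i. (B i *v hom (coords_of x i)) $ None \<noteq> 0"
  shows "(proj_map B has_derivative proj_map_deriv B x) (at x)"
proof -
  have "((\<lambda>x. proj_map B x $ q) has_derivative (\<lambda>v. proj_map_deriv B x v $ q)) (at x)" for q
  proof -
    have "((\<lambda>x. dehom (B (snd q) *v hom x)) \<circ> (\<lambda>x. coords_of x (snd q)) has_derivative
       proj_deriv (B (snd q)) (coords_of x (snd q)) \<circ> (\<lambda>x. coords_of x (snd q))) (at x)"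
      by (intro diff_chain_at linear_imp_has_derivative linear_coords_of has_derivative_proj assms)
    then show ?thesis
      unfolding proj_map_def proj_map_deriv_def vec_lambda_beta o_def
      by (rule bounded_linear.has_derivative[OF bounded_linear_vec_nth])
  qed
  then show ?thesis
    by (subst has_derivative_componentwise_within) (auto simp: Basis_vec_def inner_axis)
qed

lemma det_proj_map_deriv:
  fixes B :: "'k::finite \<Rightarrow> real^'n::finite option^'n option"
  shows "det (matrix (proj_map_deriv B x)) = (\<Prod>i\<in>UNIV. det (matrix (proj_deriv (B i) (coords_of x i))))"
proof -
  have b: "coords_of (axis q 1) i = (if snd q = i then axis (fst q) 1 else 0)" for q :: "'n \<times> 'k" and i
    by (cases q) (auto simp: coords_of_def axis_def vec_eq_iff)
  have z: "proj_deriv C y 0 = 0" for C y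
    by (simp add: proj_deriv_def vec_eq_iff linear_0[OF linear_hom_deriv])
  have "matrix (proj_map_deriv B x) = block_diagonal (\<lambda>i. matrix (proj_deriv (B i) (coords_of x i)))"
    by (auto simp: vec_eq_iff matrix_def block_diagonal_def proj_map_deriv_def b z)
  then show ?thesis by (simp add: det_block_diagonal)
qed

text \<open>
  In homogeneous terms the form is
  \<open>(\<Prod>i. det (v i, dv i, \<dots>, dv i)) / det (v 1, \<dots>, v (n + 1)) ^ (n + 1)\<close> for spanning vectors \<open>v i\<close> of
  the lines. When \<open>v i = N i *v hom x\<close>, the \<open>i\<close>-th factor of the numerator is the constant \<open>det (N i)\<close> times
  the coordinate volume form.
\<close>

definition frame_coefficient :: "('n::finite option \<Rightarrow> real^'n option^'n option) \<Rightarrow> real^('n \<times> 'n option) \<Rightarrow> real" where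
  "frame_coefficient N x = (\<Prod>i\<in>UNIV. det (N i)) / frame_det N x ^ (CARD('n) + 1)"

text \<open>
  The matrix of the projective map that \<open>A\<close> induces on the \<open>i\<close>-th line, read in the frames \<open>N i\<close> at the
  source and \<open>N' i\<close> at the target. Change of charts is the case \<open>A = mat 1\<close>.
\<close>

definition transition :: "real^'n::finite option^'n option \<Rightarrow> ('n option \<Rightarrow> real^'n option^'n option) \<Rightarrow>
    ('n option \<Rightarrow> real^'n option^'n option) \<Rightarrow> 'n option \<Rightarrow> real^'n option^'n option" where
  "transition A N N' i = matrix_inv (N' i) ** A ** N i"

definition transition_domain :: "('k::finite \<Rightarrow> real^'n::finite option^'n option) \<Rightarrow> (real^('n \<times> 'k)) set" where
  "transition_domain B = {x. \<forall>i. (B i *v hom (coords_of x i)) $ None \<noteq> 0}"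

lemma open_transition_domain: "open (transition_domain B)"
proof -
  have "open (\<Inter>i. {x. (B i *v hom (coords_of x i)) $ None \<noteq> 0})"
    by (intro open_INT ballI open_Collect_neq continuous_on_hom_coords_of continuous_intros) simp
  then show ?thesis by (simp add: transition_domain_def Inter_eq)
qed

context
  fixes A :: "real^'n::finite option^'n option" and N N' :: "'n option \<Rightarrow> real^'n option^'n option"
  assumes A: "invertible A" and N: "\<And>i. invertible (N i)" and N': "\<And>i. invertible (N' i)"
begin

lemma frame_vector_transition:
  assumes "x \<in> transition_domain (transition A N N')"
  shows "A *v frame_vector N x i =
    (transition A N N' i *v hom (coords_of x i)) $ None *\<^sub>R frame_vector N' (proj_map (transition A N N') x) i"
proof -
  let ?y = "transition A N N' i *v hom (coords_of x i)"
  have "?y $ None \<noteq> 0" using assms by (simp add: transition_domain_def)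
  then have "N' i *v ?y = N' i *v (?y $ None *\<^sub>R hom (dehom ?y))"
    by (rule arg_cong[OF hom_dehom])
  moreover have "N' i *v ?y = A *v frame_vector N x i"
    by (simp add: transition_def frame_vector_def matrix_vector_mul_assoc[symmetric] matrix_inv_vector N')
  ultimately show ?thesis
    by (simp add: frame_vector_def coords_of_proj_map matrix_vector_mult_scaleR)
qed

lemma frame_det_transition:
  assumes "x \<in> transition_domain (transition A N N')"
  shows "(\<Prod>i\<in>UNIV. (transition A N N' i *v hom (coords_of x i)) $ None) * frame_det N' (proj_map (transition A N N') x)
     = det A * frame_det N x"
proof -
  let ?w = "\<lambda>i. (transition A N N' i *v hom (coords_of x i)) $ None"
  have "det A * frame_det N x = det ((\<chi> i. frame_vector N x i) ** Finite_Cartesian_Product.transpose A)"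
    by (simp add: det_mul det_transpose frame_det_def)
  also have "(\<chi> i. frame_vector N x i) ** Finite_Cartesian_Product.transpose A = (\<chi> i. A *v frame_vector N x i)"
    by (simp add: vec_eq_iff matrix_matrix_mult_def matrix_vector_mult_def Finite_Cartesian_Product.transpose_def mult.commute)
  also have "\<dots> = (\<chi> i. ?w i *s frame_vector N' (proj_map (transition A N N') x) i)"
    by (simp add: frame_vector_transition[OF assms] scalar_mult_eq_scaleR)
  also have "det \<dots> = (\<Prod>i\<in>UNIV. ?w i) * frame_det N' (proj_map (transition A N N') x)"
    by (simp only: det_rows_mul frame_det_def)
  finally show ?thesis ..
qed

lemma frames_det_nonzero: "det A \<noteq> 0" "det (N i) \<noteq> 0" "det (N' i) \<noteq> 0"
  using A N N' by (simp_all add: invertible_det_nz)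

lemma det_transition: "det (transition A N N' i) * det (N' i) = det A * det (N i)"
proof -
  have "det (matrix_inv (N' i)) * det (N' i) = 1"
    by (metis N' det_I det_mul matrix_inv_mult(2))
  then show ?thesis by (simp add: transition_def det_mul)
qed

lemma transition_maps_to:
  assumes "x \<in> chart_image N" "x \<in> transition_domain (transition A N N')"
  shows "proj_map (transition A N N') x \<in> chart_image N'"
  using frame_det_transition[OF assms(2)] frames_det_nonzero(1) assms(1)
  by (auto simp: chart_image_def)

text \<open>
  With \<open>W\<close> the product of the denominators of the projective maps, the Jacobian contributes
  \<open>W ^ -(n + 1)\<close> and the determinant of the spanning vectors in the target chart is \<open>det A / W\<close> times
  that in the source chart. The powers of \<open>W\<close> cancel because this determinant occurs to the power
  \<open>n + 1\<close>, and the powers of \<open>det A\<close> cancel because there are \<open>n + 1\<close> lines.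
\<close>

lemma frame_coefficient_transition:
  assumes x: "x \<in> chart_image N" "x \<in> transition_domain (transition A N N')"
  shows "frame_coefficient N' (proj_map (transition A N N') x) * det (matrix (proj_map_deriv (transition A N N') x))
     = frame_coefficient N x"
proof -
  define m where "m = CARD('n) + 1"
  have m: "m = CARD('n option)" by (simp add: m_def card_option)
  define W where "W = (\<Prod>i\<in>UNIV. (transition A N N' i *v hom (coords_of x i)) $ None)"
  define J where "J = det (matrix (proj_map_deriv (transition A N N') x))"
  define n n' where "n = (\<Prod>i\<in>UNIV. det (N i))" and "n' = (\<Prod>i\<in>UNIV. det (N' i))"
  define D D' where "D = frame_det N x" and "D' = frame_det N' (proj_map (transition A N N') x)"
  have "W \<noteq> 0" using x(2) by (simp add: W_def transition_domain_def)
  have "D \<noteq> 0" using x(1) by (simp add: D_def chart_image_def)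
  have "D' \<noteq> 0" using transition_maps_to[OF x] by (simp add: D'_def chart_image_def)
  have 1: "W * D' = det A * D"
    using frame_det_transition[OF x(2)] by (simp add: W_def D_def D'_def)
  have "(\<Prod>i\<in>UNIV. det (transition A N N' i)) = W ^ m * J"
  proof -
    have "(\<Prod>i\<in>UNIV. det (transition A N N' i)) = (\<Prod>i\<in>UNIV. ((transition A N N' i *v hom (coords_of x i)) $ None) ^ m
        * det (matrix (proj_deriv (transition A N N' i) (coords_of x i))))"
      unfolding m_def using x(2) by (intro prod.cong det_proj_deriv) (auto simp: transition_domain_def)
    then show ?thesis by (simp add: prod.distrib prod_power_distrib W_def J_def det_proj_map_deriv)
  qed
  moreover have "(\<Prod>i\<in>UNIV. det (transition A N N' i)) * n' = det A ^ m * n"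
    unfolding n_def n'_def prod.distrib[symmetric] det_transition by (simp add: prod.distrib m)
  ultimately have 2: "W ^ m * J * n' = det A ^ m * n" by simp
  \<comment> \<open>The claim, cleared of denominators, is multiplied by \<open>W ^ m\<close> so that both relations apply.\<close>
  have "(n' * J * D ^ m) * W ^ m = (W ^ m * J * n') * D ^ m" by (simp add: algebra_simps)
  also have "\<dots> = n * (det A * D) ^ m" unfolding 2 by (simp add: power_mult_distrib algebra_simps)
  also have "\<dots> = (n * D' ^ m) * W ^ m" unfolding 1[symmetric] by (simp add: power_mult_distrib algebra_simps)
  finally have "n' * J * D ^ m = n * D' ^ m" using \<open>W \<noteq> 0\<close> by simp
  then have "n' / D' ^ m * J = n / D ^ m"
    using \<open>D \<noteq> 0\<close> \<open>D' \<noteq> 0\<close> by (simp add: field_simps)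
  then show ?thesis
    by (simp add: frame_coefficient_def n_def n'_def D_def D'_def J_def m_def)
qed

end

text \<open>
  Both the identity and the elements of the projective group act in this way, so that one computation
  shows that the form is well defined and that it is invariant.
\<close>

definition acts_as :: "('n::finite option proj^'n option \<Rightarrow> 'n option proj^'n option) \<Rightarrow> real^'n option^'n option \<Rightarrow> bool" where
  "acts_as g A \<longleftrightarrow> invertible A \<and>
     (\<forall>v. (\<forall>i. v i \<noteq> 0) \<longrightarrow> g (\<chi> i. line_of (v i)) = (\<chi> i. line_of (A *v v i)))"

lemma acts_as_id: "acts_as id (mat 1)"
  by (simp add: acts_as_def invertible_det_nz)

context
  fixes c c' :: "('n::finite option proj^'n option, 'n \<times> 'n option) chart" 
    and N N' and g :: "'n option proj^'n option \<Rightarrow> 'n option proj^'n option" and A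
  assumes cN: "chart_frame c N" and cN': "chart_frame c' N'" and gA: "acts_as g A"
begin

lemma acts_as_frame_lines: "g (frame_lines N x) = (\<chi> i. line_of (A *v frame_vector N x i))"
  using gA frame_vector_nonzero[where N=N, OF chart_frame_invertible[OF cN]]
  by (simp add: acts_as_def frame_lines_def)

lemma A_frame_vector_nonzero: "A *v frame_vector N x i \<noteq> 0"
  using gA frame_vector_nonzero[where N=N, OF chart_frame_invertible[OF cN]]
  by (simp add: acts_as_def invertible_mult_eq_0_iff)

lemma acts_as_invertible: "invertible A" using gA by (simp add: acts_as_def)

text \<open>
  A moved line meets the target hyperplane exactly when the denominator of the projective map is nonzero,
  and then both sides are spanned by proportional vectors.
\<close>

lemma acts_as_in_domain_iff:
  assumes "x \<in> chart_image N"
  shows "g (frame_lines N x) \<in> fst c' \<longleftrightarrow> x \<in> transition_domain (transition A N N')"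
    and "x \<in> transition_domain (transition A N N') \<Longrightarrow>
      g (frame_lines N x) = frame_lines N' (proj_map (transition A N N') x)"
proof -
  note inv = acts_as_invertible chart_frame_invertible[OF cN] chart_frame_invertible[OF cN']
  have *: "g (frame_lines N x) = frame_lines N' (proj_map (transition A N N') x)"
    if d: "x \<in> transition_domain (transition A N N')"
  proof -
    have "line_of (A *v frame_vector N x i) = line_of (frame_vector N' (proj_map (transition A N N') x) i)" for i
    proof (subst line_of_eq_iff)
      show "A *v frame_vector N x i \<noteq> 0" by (rule A_frame_vector_nonzero)
      show "frame_vector N' (proj_map (transition A N N') x) i \<noteq> 0"
        by (rule frame_vector_nonzero[where N=N', OF chart_frame_invertible[OF cN']])
      show "\<exists>t. t \<noteq> 0 \<and> A *v frame_vector N x i = t *\<^sub>R frame_vector N' (proj_map (transition A N N') x) i"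
        using frame_vector_transition[where A=A and N=N and N'=N', OF inv d] d
        by (intro exI[of _ "(transition A N N' i *v hom (coords_of x i)) $ None"])
           (simp add: transition_domain_def)
    qed
    then show ?thesis unfolding acts_as_frame_lines by (simp add: frame_lines_def)
  qed
  then show "x \<in> transition_domain (transition A N N') \<Longrightarrow>
      g (frame_lines N x) = frame_lines N' (proj_map (transition A N N') x)" .
  show "g (frame_lines N x) \<in> fst c' \<longleftrightarrow> x \<in> transition_domain (transition A N N')"
  proof
    assume "x \<in> transition_domain (transition A N N')"
    then show "g (frame_lines N x) \<in> fst c'"
      using * transition_maps_to[where A=A and N=N and N'=N', OF inv assms] frame_lines_in_domain[OF cN'] by metis
  next
    assume "g (frame_lines N x) \<in> fst c'"
    then have "line_in_chart (N' i) (line_of (A *v frame_vector N x i))" for i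
      using cN' unfolding acts_as_frame_lines by (simp add: chart_frame_def)
    then show "x \<in> transition_domain (transition A N N')"
      unfolding line_in_chart_line_of[OF A_frame_vector_nonzero]
      by (simp add: transition_domain_def transition_def frame_vector_def matrix_vector_mul_assoc matrix_mul_assoc)
  qed
qed

lemma has_derivative_in_charts:
  assumes "x \<in> chart_image N" "g (frame_lines N x) \<in> fst c'"
  shows "((snd c' \<circ> g \<circ> chart_inv c) has_derivative proj_map_deriv (transition A N N') x) (at x)"
    and "snd c' (g (frame_lines N x)) = proj_map (transition A N N') x"
proof -
  let ?S = "chart_image N \<inter> transition_domain (transition A N N')"
  note inv = acts_as_invertible chart_frame_invertible[OF cN] chart_frame_invertible[OF cN']
  have x: "x \<in> ?S" using assms acts_as_in_domain_iff(1) by simp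
  have *: "snd c' (g (frame_lines N y)) = proj_map (transition A N N') y" if "y \<in> ?S" for y
    using that acts_as_in_domain_iff(2) transition_maps_to[where A=A and N=N and N'=N', OF inv]
      chart_frame_lines[OF cN'] by simp
  then show "snd c' (g (frame_lines N x)) = proj_map (transition A N N') x" using x .
  have "(proj_map (transition A N N') has_derivative proj_map_deriv (transition A N N') x) (at x)"
    using x by (intro has_derivative_proj_map) (simp add: transition_domain_def)
  then show "((snd c' \<circ> g \<circ> chart_inv c) has_derivative proj_map_deriv (transition A N N') x) (at x)"
  proof (rule has_derivative_transform_within_open[of _ _ _ _ ?S])
    show "open ?S" by (intro open_Int open_chart_image open_transition_domain)
    show "proj_map (transition A N N') y = (snd c' \<circ> g \<circ> chart_inv c) y" if "y \<in> ?S" for y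
      using that * by (simp add: chart_inv_eq[OF cN])
  qed (rule x)
qed

lemma frame_coefficient_acts_as:
  assumes "x \<in> chart_image N" "g (frame_lines N x) \<in> fst c'"
  defines "D \<equiv> frechet_derivative (snd c' \<circ> g \<circ> chart_inv c) (at x)"
  shows "linear D" "frame_coefficient N' (snd c' (g (frame_lines N x))) * det (matrix D) = frame_coefficient N x"
proof -
  note d = has_derivative_in_charts[OF assms(1,2)]
  have D: "D = proj_map_deriv (transition A N N') x"
    unfolding D_def using frechet_derivative_at[OF d(1)] by simp
  show "linear D" unfolding D using d(1) by (rule has_derivative_linear)
  show "frame_coefficient N' (snd c' (g (frame_lines N x))) * det (matrix D) = frame_coefficient N x"
    unfolding D d(2) using assms(1,2) acts_as_in_domain_iff(1)
    by (intro frame_coefficient_transition acts_as_invertible chart_frame_invertible[OF cN] chart_frame_invertible[OF cN']) auto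
qed

end

text \<open>
  Different matrices describe the same chart, for instance nonzero multiples of each other. Any two such
  families are related by a transition map, which is the identity here.
\<close>

lemma frame_coefficient_unique:
  assumes "chart_frame c N" "chart_frame c N'" "x \<in> chart_image N"
  shows "frame_coefficient N x = frame_coefficient N' x"
proof -
  have inN': "x \<in> chart_image N'" "frame_lines N x \<in> fst c"
    using assms chart_image_eq frame_lines_in_domain by metis+
  have "((snd c \<circ> id \<circ> chart_inv c) has_derivative id) (at x)"
  proof (rule has_derivative_transform_within_open[of "\<lambda>y. y" _ _ UNIV "chart_image N"])
    show "((\<lambda>y. y) has_derivative id) (at x)" using has_derivative_id by (simp add: id_def)
    show "y = (snd c \<circ> id \<circ> chart_inv c) y" if "y \<in> chart_image N" for y
      using that by (simp add: chart_inv_eq[OF assms(1)] chart_frame_lines[OF assms(1)])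
  qed (use open_chart_image assms(3) in auto)
  then have D: "frechet_derivative (snd c \<circ> id \<circ> chart_inv c) (at x) = id"
    using frechet_derivative_at by metis
  have "matrix (id :: real^('a \<times> 'a option) \<Rightarrow> _) = mat 1" by (simp add: matrix_id_mat_1)
  then show ?thesis
    using frame_coefficient_acts_as(2)[OF assms(1,2) acts_as_id assms(3)] inN'
    unfolding D by (simp add: chart_frame_lines[OF assms(1,3)])
qed

definition frame_of :: "('n::finite option proj^'n option, 'n \<times> 'n option) chart \<Rightarrow> 'n option \<Rightarrow> real^'n option^'n option" where
  "frame_of c = (SOME N. chart_frame c N)"

text \<open>
  The constant makes this form equal to \<^const>\<open>omega_plane\<close> in the chart of any single hyperplane: it
  turns the determinant of the vectors \<open>(1, A i)\<close> into the volume of their simplex.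
\<close>

definition the_moebius_form :: "('n::finite option proj^'n option, 'n \<times> 'n option) form" where
  "the_moebius_form c x v = fact CARD('n) ^ (CARD('n) + 1) * frame_coefficient (frame_of c) x * wedge dx v"

lemma chart_frame_frame_of:
  assumes "c \<in> FCF_atlas"
  shows "chart_frame c (frame_of c)"
proof -
  obtain P e where c: "c = FCF_chart P e" and "\<forall>i. euclidean_hyperplane (P i) (e i)"
    using assms by (auto simp: FCF_atlas_def)
  then have "\<forall>i. \<exists>N. affine_frame (P i) (e i) N" using euclidean_hyperplane_affine_frame by metis
  then obtain N where "\<And>i. affine_frame (P i) (e i) (N i)" by metis
  then have "chart_frame c N" unfolding c by (rule chart_frame_FCF_chart)
  then show ?thesis unfolding frame_of_def by (rule someI[of "chart_frame c"])
qed

lemma pullback_agrees_the_moebius_form: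
  assumes "c \<in> FCF_atlas" "c' \<in> FCF_atlas" "acts_as g A"
  shows "pullback_agrees the_moebius_form g c c'"
  unfolding pullback_agrees_def
proof (intro ballI impI allI)
  fix p v assume p: "p \<in> fst c" and gp: "g p \<in> fst c'"
  note f = chart_frame_frame_of[OF assms(1)] chart_frame_frame_of[OF assms(2)]
  let ?D = "frechet_derivative (snd c' \<circ> g \<circ> chart_inv c) (at (snd c p))"
  note x = chart_domain_cases[OF f(1) p]
  have gp': "g (frame_lines (frame_of c) (snd c p)) \<in> fst c'" using gp x(2) by simp
  note * = frame_coefficient_acts_as[OF f assms(3) x(1) gp', folded x(2)]
  show "the_moebius_form c (snd c p) v = the_moebius_form c' (snd c' (g p)) (\<lambda>k. ?D (v k))"
    unfolding the_moebius_form_def wedge_dx_linear[OF *(1)] *(2)[symmetric] by simp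
qed

lemma PGL_acts_as:
  assumes "G \<in> PGL"
  obtains A where "acts_as (PGL_FCF G) A"
proof -
  obtain A where A: "invertible A" and G: "G = {B. invertible B \<and> (\<exists>t. t \<noteq> 0 \<and> B = t *\<^sub>R A)}"
    using assms by (auto simp: PGL_def quotient_def Image_def)
  have "PGL_line G (line_of v) = line_of (A *v v)" if "v \<noteq> 0" for v
  proof -
    have AG: "A \<in> G" using A G by (auto intro!: exI[of _ 1])
    have "(\<Union>B\<in>G. (\<lambda>x. B *v x) ` span {v}) = span {A *v v}"
    proof
      show "(\<Union>B\<in>G. (\<lambda>x. B *v x) ` span {v}) \<subseteq> span {A *v v}"
        by (auto simp: G span_singleton matrix_vector_mult_scaleR scaleR_matrix_vector_assoc[symmetric])
      have "k *\<^sub>R (A *v v) \<in> (\<lambda>x. A *v x) ` span {v}" for k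
        unfolding matrix_vector_mult_scaleR[symmetric] by (intro imageI span_mul span_base) simp
      then show "span {A *v v} \<subseteq> (\<Union>B\<in>G. (\<lambda>x. B *v x) ` span {v})"
        using AG unfolding span_singleton by blast
    qed
    then show ?thesis
      unfolding PGL_line_def line_set_line_of[OF that] by (simp add: line_of_def)
  qed
  then have "acts_as (PGL_FCF G) A"
    using A by (simp add: acts_as_def PGL_FCF_def)
  then show ?thesis by (rule that)
qed

theorem Moebius_form_the_moebius_form: "Moebius_form the_moebius_form"
  unfolding Moebius_form_def top_form_def invariant_form_def
proof (intro conjI ballI allI)
  fix c c' :: "('n::finite option proj^'n option, 'n \<times> 'n option) chart" and x v
  assume c: "c \<in> FCF_atlas"
  note f = chart_frame_frame_of[OF c]
  have im: "snd c ` fst c = chart_image (frame_of c)" by (rule chart_image_eq[OF f])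
  show "alternating_multilinear (the_moebius_form c x)"
    unfolding the_moebius_form_def[abs_def] by (rule alternating_multilinear_wedge_dx)
  have "rational_on (chart_image (frame_of c)) (\<lambda>x. the_moebius_form c x v)"
    unfolding the_moebius_form_def frame_coefficient_def divide_inverse
    by (intro rational_on.mult rational_on.const rational_on.inverse rational_on_power rational_on_frame_det)
      (simp add: chart_image_def)
  then show "smooth_on (snd c ` fst c) (\<lambda>x. the_moebius_form c x v)"
    unfolding im by (rule rational_on_imp_smooth_on[OF open_chart_image])
  assume c': "c' \<in> FCF_atlas"
  show "pullback_agrees the_moebius_form id c c'"
    by (rule pullback_agrees_the_moebius_form[OF c c' acts_as_id])
  fix G :: "(real^'n option^'n option) set"
  assume "G \<in> PGL"
  then show "pullback_agrees the_moebius_form (PGL_FCF G) c c'"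
    using PGL_acts_as pullback_agrees_the_moebius_form[OF c c'] by metis
qed

section \<open>The measure of the invariant form\<close>

definition moebius_density :: "('n::finite option proj^'n option, 'n \<times> 'n option) chart \<Rightarrow> real^('n \<times> 'n option) \<Rightarrow> real" where
  "moebius_density c x = fact CARD('n) ^ (CARD('n) + 1) * frame_coefficient (frame_of c) x"

lemma coefficient_the_moebius_form: "coefficient the_moebius_form c x = moebius_density c x"
  by (simp add: coefficient_def the_moebius_form_def moebius_density_def wedge_dx_axis)

definition chart_preimage :: "('n::finite option proj^'n option, 'n \<times> 'n option) chart \<Rightarrow>
    ('n option proj^'n option) set \<Rightarrow> (real^('n \<times> 'n option)) set" where
  "chart_preimage c S = {x \<in> chart_image (frame_of c). frame_lines (frame_of c) x \<in> S}"

text \<open>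
  The denominators are nonconstant affine functions or nonzero constants, since \<open>B i\<close> has no zero row.
\<close>

lemma negligible_proj_map_pole:
  fixes B :: "'k::finite \<Rightarrow> real^'n::finite option^'n option"
  assumes "\<And>i. invertible (B i)"
  shows "negligible (- transition_domain B)"
proof -
  have "negligible {x. (B i *v hom (coords_of x i)) $ None = 0}" for i
  proof -
    define a where "a = (\<chi> q. if snd q = i then B i $ None $ Some (fst q) else 0)"
    have "(B i *v hom (coords_of x i)) $ None = B i $ None $ None + a \<bullet> x" for x
    proof -
      have "a \<bullet> x = (\<Sum>q\<in>UNIV \<times> UNIV. a $ q * x $ q)" by (simp add: inner_vec_def)
      also have "\<dots> = (\<Sum>j\<in>UNIV. \<Sum>k\<in>UNIV. a $ (j, k) * x $ (j, k))"
        by (simp add: sum.cartesian_product del: UNIV_Times_UNIV)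
      also have "\<dots> = (\<Sum>j\<in>UNIV. B i $ None $ Some j * x $ (j, i))"
        by (simp add: a_def if_distrib[of "\<lambda>z. z * _"] cong: if_cong)
      finally show ?thesis
        by (simp add: matrix_vector_mult_def sum_UNIV_option coords_of_def)
    qed
    then have "{x. (B i *v hom (coords_of x i)) $ None = 0} = {x. a \<bullet> x = - B i $ None $ None}"
      by auto
    moreover have "a \<noteq> 0 \<or> - B i $ None $ None \<noteq> 0"
    proof (rule ccontr)
      assume "\<not> ?thesis"
      then have "a = 0" "B i $ None $ None = 0" by auto
      then have "a $ (j, i) = 0" for j by simp
      then have "B i $ None $ q = 0" for q
        using \<open>B i $ None $ None = 0\<close> by (cases q) (simp_all add: a_def)
      then have "row None (B i) = 0" by (simp add: row_def vec_eq_iff)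
      then show False using assms[of i] det_zero_row(2) by (metis invertible_det_nz)
    qed
    ultimately show ?thesis by (metis negligible_hyperplane)
  qed
  then have "negligible (\<Union>i. {x. (B i *v hom (coords_of x i)) $ None = 0})"
    by (intro negligible_Union) auto
  also have "(\<Union>i. {x. (B i *v hom (coords_of x i)) $ None = 0}) = - transition_domain B"
    by (auto simp: transition_domain_def)
  finally show ?thesis .
qed

lemma restrict_borel_open: "open T \<Longrightarrow> A \<inter> T \<in> sets (restrict_space borel A)"
  unfolding sets_restrict_space by (intro imageI borel_open)

lemma chart_domain_sets:
  assumes "c \<in> FCF_atlas"
  shows "fst c \<in> sets (restrict_space borel FCF)" "fst c \<subseteq> FCF"
proof -
  obtain T where T: "open T" "fst c = FCF \<inter> T"
    using openin_chart_domain[OF chart_frame_frame_of[OF assms]] by (elim exE conjE) (rule that)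
  show "fst c \<in> sets (restrict_space borel FCF)"
    unfolding T(2) by (rule restrict_borel_open[OF T(1)])
  show "fst c \<subseteq> FCF" unfolding T(2) by (rule Int_lower1)
qed

lemma chart_preimage_sets:
  assumes c: "c \<in> FCF_atlas" and S: "S \<in> sets (restrict_space borel FCF)"
  shows "chart_preimage c S \<in> sets borel"
proof -
  note f = chart_frame_frame_of[OF c]
  let ?U = "chart_image (frame_of c)"
  have "?U \<in> sets borel" by (simp add: borel_open open_chart_image)
  obtain T where T: "T \<in> sets borel" "S = FCF \<inter> T" using S by (auto simp: sets_restrict_space)
  have "frame_lines (frame_of c) \<in> borel_measurable borel"
    by (intro borel_measurable_continuous_onI continuous_on_frame_lines[OF f])
  from measurable_sets[OF this T(1)] have "frame_lines (frame_of c) -` T \<in> sets borel" by simp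
  moreover have "chart_preimage c S = ?U \<inter> frame_lines (frame_of c) -` T"
    using frame_lines_in_FCF_iff[OF f] by (auto simp: chart_preimage_def T)
  ultimately show ?thesis using \<open>?U \<in> sets borel\<close> by auto
qed

lemma chart_preimage_eq_image:
  assumes c: "c \<in> FCF_atlas" and "S \<subseteq> fst c"
  shows "snd c ` S = chart_preimage c S"
proof
  note f = chart_frame_frame_of[OF c]
  show "snd c ` S \<subseteq> chart_preimage c S"
    using assms(2) chart_domain_cases[OF f] by (auto simp: chart_preimage_def)
  show "chart_preimage c S \<subseteq> snd c ` S"
    using chart_frame_lines[OF f] by (force simp: chart_preimage_def image_iff)
qed

lemma continuous_on_moebius_density: "continuous_on (chart_image (frame_of c)) (moebius_density c)"
  unfolding moebius_density_def frame_coefficient_def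
  by (intro continuous_intros rational_on_continuous_on rational_on_frame_det) (simp add: chart_image_def)

lemma moebius_density_nonzero:
  assumes c: "c \<in> FCF_atlas" and "x \<in> chart_image (frame_of c)"
  shows "moebius_density c x \<noteq> 0"
  using assms(2) chart_frame_invertible[OF chart_frame_frame_of[OF c]]
  by (simp add: moebius_density_def frame_coefficient_def chart_image_def invertible_det_nz)

lemma moebius_density_measurable:
  assumes "X \<in> sets borel" "X \<subseteq> chart_image (frame_of c)"
  shows "(\<lambda>x. indicator X x * \<bar>moebius_density c x\<bar>) \<in> borel_measurable borel"
proof -
  have "continuous_on X (\<lambda>x. \<bar>moebius_density c x\<bar>)"
    by (intro continuous_intros continuous_on_subset[OF continuous_on_moebius_density] assms(2))
  then show ?thesis
    using borel_measurable_continuous_on_indicator[OF assms(1), of "\<lambda>x. \<bar>moebius_density c x\<bar>"] by simp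
qed

definition chart_mass :: "('n::finite option proj^'n option, 'n \<times> 'n option) chart \<Rightarrow> ('n option proj^'n option) set \<Rightarrow> ennreal" where
  "chart_mass c S = (\<integral>\<^sup>+x. ennreal (indicator (chart_preimage c S) x * \<bar>moebius_density c x\<bar>) \<partial>lborel)"

text \<open>
  The measure on the whole manifold is transported from one chart. This loses nothing, because the
  frames outside of that chart form a null set in every other chart.
\<close>

definition moebius_measure_in :: "('n::finite option proj^'n option, 'n \<times> 'n option) chart \<Rightarrow> ('n option proj^'n option) measure" where
  "moebius_measure_in c = distr (density (restrict_space lborel (chart_image (frame_of c))) (\<lambda>x. ennreal \<bar>moebius_density c x\<bar>))
     (restrict_space borel FCF) (frame_lines (frame_of c))"

lemma sets_moebius_measure_in [simp]: "sets (moebius_measure_in c) = sets (restrict_space borel FCF)"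
  and space_moebius_measure_in [simp]: "space (moebius_measure_in c) = FCF"
  by (simp_all add: moebius_measure_in_def space_restrict_space)

lemma emeasure_moebius_measure_in:
  assumes c: "c \<in> FCF_atlas" and S: "S \<in> sets (restrict_space borel FCF)"
  shows "emeasure (moebius_measure_in c) S = chart_mass c S"
proof -
  note f = chart_frame_frame_of[OF c]
  let ?U = "chart_image (frame_of c)"
  have U: "?U \<in> sets borel" by (simp add: borel_open open_chart_image)
  let ?R = "restrict_space lborel ?U"
  have d: "(\<lambda>x. ennreal \<bar>moebius_density c x\<bar>) \<in> borel_measurable ?R"
  proof -
    have "moebius_density c \<in> borel_measurable (restrict_space borel ?U)"
      by (rule borel_measurable_continuous_on_restrict[OF continuous_on_moebius_density])
    moreover have "sets (restrict_space borel ?U) = sets ?R" by (simp add: sets_restrict_space)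
    ultimately have [measurable]: "moebius_density c \<in> borel_measurable ?R"
      by (simp cong: measurable_cong_sets)
    show ?thesis by measurable
  qed
  have fl: "frame_lines (frame_of c) \<in> ?R \<rightarrow>\<^sub>M restrict_space borel FCF"
  proof (rule measurable_restrict_space2)
    show "frame_lines (frame_of c) \<in> space ?R \<rightarrow> FCF"
      using frame_lines_in_FCF_iff[OF f] by (simp add: space_restrict_space)
    have "frame_lines (frame_of c) \<in> borel_measurable lborel"
      using borel_measurable_continuous_onI[OF continuous_on_frame_lines[OF f]] by simp
    then show "frame_lines (frame_of c) \<in> ?R \<rightarrow>\<^sub>M borel"
      by (rule measurable_restrict_space1)
  qed
  have pre: "frame_lines (frame_of c) -` S \<inter> space ?R = chart_preimage c S"
    by (auto simp: chart_preimage_def space_restrict_space)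
  then have preR: "chart_preimage c S \<in> sets ?R" using measurable_sets[OF fl S] by simp
  have "emeasure (moebius_measure_in c) S
      = emeasure (density ?R (\<lambda>x. ennreal \<bar>moebius_density c x\<bar>)) (chart_preimage c S)"
    unfolding moebius_measure_in_def using fl S pre by (subst emeasure_distr) auto
  also have "\<dots> = (\<integral>\<^sup>+x. ennreal \<bar>moebius_density c x\<bar> * indicator (chart_preimage c S) x \<partial>?R)"
    by (rule emeasure_density[OF d preR])
  also have "\<dots> = (\<integral>\<^sup>+x. ennreal \<bar>moebius_density c x\<bar> * indicator (chart_preimage c S) x * indicator ?U x \<partial>lborel)"
    using U by (subst nn_integral_restrict_space) auto
  also have "\<dots> = chart_mass c S"
    unfolding chart_mass_def by (intro nn_integral_cong) (auto simp: indicator_def chart_preimage_def)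
  finally show ?thesis .
qed

text \<open>
  On the intersection of the two chart domains this is change of variables along the transition map, whose
  Jacobian is the quotient of the densities; the rest of \<open>S\<close> lies over the poles of the transition map.
\<close>

lemma chart_mass_change_of_chart:
  assumes c: "c \<in> FCF_atlas" and c0: "c0 \<in> FCF_atlas"
    and S: "S \<in> sets (restrict_space borel FCF)" "S \<subseteq> fst c"
  shows "chart_mass c S = chart_mass c0 S"
proof -
  note f = chart_frame_frame_of[OF c] and f0 = chart_frame_frame_of[OF c0]
  define B where "B = transition (mat 1) (frame_of c) (frame_of c0)"
  define T where "T = chart_preimage c S \<inter> transition_domain B"
  have dom: "frame_lines (frame_of c) x \<in> fst c0 \<longleftrightarrow> x \<in> transition_domain B"
    and eq: "x \<in> transition_domain B \<Longrightarrow> frame_lines (frame_of c) x = frame_lines (frame_of c0) (proj_map B x)"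
    if "x \<in> chart_image (frame_of c)" for x
    using acts_as_in_domain_iff[OF f f0 acts_as_id that] unfolding B_def by simp_all
  have T_U: "T \<subseteq> chart_image (frame_of c)" by (auto simp: T_def chart_preimage_def)
  have inU0: "proj_map B x \<in> chart_image (frame_of c0)" if "x \<in> T" for x
    using that T_U transition_maps_to[of "mat 1" "frame_of c" "frame_of c0" x] chart_frame_invertible[OF f] chart_frame_invertible[OF f0]
    by (auto simp: T_def B_def acts_as_id[unfolded acts_as_def])
  have Tb: "T \<in> sets borel"
    unfolding T_def by (intro sets.Int chart_preimage_sets[OF c S(1)] borel_open open_transition_domain)
  have img: "proj_map B ` T = chart_preimage c0 S"
  proof
    show "proj_map B ` T \<subseteq> chart_preimage c0 S"
      using inU0 eq by (auto simp: T_def chart_preimage_def)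
    show "chart_preimage c0 S \<subseteq> proj_map B ` T"
    proof
      fix y assume y: "y \<in> chart_preimage c0 S"
      define l where "l = frame_lines (frame_of c0) y"
      have l: "l \<in> S" "l \<in> fst c0" "snd c0 l = y"
        using y frame_lines_in_domain[OF f0] chart_frame_lines[OF f0] by (auto simp: l_def chart_preimage_def)
      then have lc: "l \<in> fst c" using S(2) by auto
      define x where "x = snd c l"
      have x: "x \<in> chart_image (frame_of c)" "l = frame_lines (frame_of c) x"
        using chart_domain_cases[OF f lc] by (simp_all add: x_def)
      then have xB: "x \<in> transition_domain B" using dom l(2) by simp
      then have xT: "x \<in> T" using x l(1) by (simp add: T_def chart_preimage_def)
      have "y = proj_map B x"
        using l(3) eq[OF x(1) xB] chart_frame_lines[OF f0 inU0[OF xT]] x(2) by simp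
      then show "y \<in> proj_map B ` T" using xT by blast
    qed
  qed
  have inj: "inj_on (proj_map B) T"
  proof (rule inj_onI)
    fix x y assume xy: "x \<in> T" "y \<in> T" "proj_map B x = proj_map B y"
    have "frame_lines (frame_of c) z = frame_lines (frame_of c0) (proj_map B z)" if "z \<in> T" for z
      using that T_U by (intro eq) (auto simp: T_def)
    then have "frame_lines (frame_of c) x = frame_lines (frame_of c) y" using xy by simp
    then show "x = y" using chart_frame_lines[OF f] xy(1,2) T_U by (metis subsetD)
  qed
  have dens: "\<bar>det (matrix (proj_map_deriv B x))\<bar> * \<bar>moebius_density c0 (proj_map B x)\<bar> = \<bar>moebius_density c x\<bar>"
    if "x \<in> T" for x
  proof -
    have "frame_coefficient (frame_of c0) (proj_map B x) * det (matrix (proj_map_deriv B x)) = frame_coefficient (frame_of c) x"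
      unfolding B_def using that T_U chart_frame_invertible[OF f] chart_frame_invertible[OF f0]
      by (intro frame_coefficient_transition) (auto simp: T_def B_def acts_as_id[unfolded acts_as_def])
    then have "moebius_density c x = moebius_density c0 (proj_map B x) * det (matrix (proj_map_deriv B x))"
      by (simp add: moebius_density_def)
    then show ?thesis by (simp add: abs_mult mult.commute)
  qed
  have "chart_mass c0 S = (\<integral>\<^sup>+x. ennreal (indicator (proj_map B ` T) x * \<bar>moebius_density c0 x\<bar>) \<partial>lborel)"
    by (simp add: chart_mass_def img)
  also have "\<dots> = (\<integral>\<^sup>+x. ennreal (indicator T x * (\<bar>det (matrix (proj_map_deriv B x))\<bar> * \<bar>moebius_density c0 (proj_map B x)\<bar>)) \<partial>lborel)"
  proof (rule nn_integral_change_of_variables[OF Tb _ inj])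
    show "(proj_map B has_derivative proj_map_deriv B x) (at x within T)" if "x \<in> T" for x
    proof -
      have "\<forall>i. (B i *v hom (coords_of x i)) $ None \<noteq> 0"
        using that by (simp add: T_def transition_domain_def)
      then have "(proj_map B has_derivative proj_map_deriv B x) (at x)" by (intro has_derivative_proj_map) blast
      then show ?thesis by (rule has_derivative_at_withinI)
    qed
    show "(\<lambda>x. indicator (proj_map B ` T) x * \<bar>moebius_density c0 x\<bar>) \<in> borel_measurable borel"
      unfolding img by (intro moebius_density_measurable chart_preimage_sets[OF c0 S(1)]) (auto simp: chart_preimage_def)
    have "(\<lambda>x. indicator T x * (\<bar>det (matrix (proj_map_deriv B x))\<bar> * \<bar>moebius_density c0 (proj_map B x)\<bar>))
        = (\<lambda>x. indicator T x * \<bar>moebius_density c x\<bar>)"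
      using dens by (auto simp: indicator_def fun_eq_iff)
    then show "(\<lambda>x. indicator T x * (\<bar>det (matrix (proj_map_deriv B x))\<bar> * \<bar>moebius_density c0 (proj_map B x)\<bar>)) \<in> borel_measurable borel"
      using moebius_density_measurable[OF Tb T_U] by simp
  qed simp
  also have "\<dots> = chart_mass c S"
    unfolding chart_mass_def
  proof (rule nn_integral_cong_AE)
    have "det (B i) \<noteq> 0" for i
      using det_transition[of "mat 1" "frame_of c" "frame_of c0" i] chart_frame_invertible[OF f] chart_frame_invertible[OF f0]
      by (auto simp: B_def invertible_det_nz)
    then have "negligible (- transition_domain B)"
      by (intro negligible_proj_map_pole) (simp add: invertible_det_nz)
    moreover have "- transition_domain B \<in> sets lborel"
      using open_transition_domain[of B] by (simp add: borel_closed closed_Compl)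
    ultimately have "- transition_domain B \<in> null_sets lborel"
      by (simp add: negligible_iff_null_sets null_sets_completion_iff)
    from AE_not_in[OF this] have "AE x in lborel. x \<in> transition_domain B" by simp
    then show "AE x in lborel. ennreal (indicator T x * (\<bar>det (matrix (proj_map_deriv B x))\<bar> * \<bar>moebius_density c0 (proj_map B x)\<bar>))
       = ennreal (indicator (chart_preimage c S) x * \<bar>moebius_density c x\<bar>)"
      by eventually_elim (use dens in \<open>auto simp: indicator_def T_def\<close>)
  qed
  finally show ?thesis ..
qed

text \<open>
  The value does not depend on the countable cover, because each piece of the cut has the same mass in its
  own chart as in \<open>c0\<close>.
\<close>

lemma positive_integral_signed_density:
  assumes \<A>: "\<A> \<subseteq> FCF_atlas" and c0: "c0 \<in> FCF_atlas" and cover: "\<exists>k. chart_cover \<A> S k"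
    and S: "S \<in> sets (restrict_space borel FCF)"
    and \<omega>: "\<And>c x. c \<in> \<A> \<Longrightarrow> x \<in> chart_image (frame_of c) \<Longrightarrow> coefficient \<omega> c x = moebius_density c x"
    and s: "\<And>c p. c \<in> \<A> \<Longrightarrow> p \<in> S \<inter> fst c \<Longrightarrow> s c p = \<epsilon> * sgn (moebius_density c (snd c p))"
    and \<epsilon>: "\<epsilon> \<in> {1, -1}"
  shows "positive_integral \<A> s \<omega> S = (if \<epsilon> = 1 then emeasure (moebius_measure_in c0) S else 0)"
proof -
  define k where "k = (SOME k. chart_cover \<A> S k)"
  have "chart_cover \<A> S k" unfolding k_def by (rule someI_ex[OF cover])
  then have k: "k i \<in> \<A>" "S \<subseteq> (\<Union>i. fst (k i))" for i by (auto simp: chart_cover_def)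
  define D where "D i = S \<inter> disjointed (\<lambda>i. fst (k i)) i" for i
  have kA: "k i \<in> FCF_atlas" for i using k \<A> by auto
  have D_sub: "D i \<subseteq> fst (k i)" "D i \<subseteq> S" for i
    using disjointed_subset[of "\<lambda>i. fst (k i)" i] by (auto simp: D_def)
  have "range (\<lambda>i. fst (k i)) \<subseteq> sets (restrict_space borel FCF)"
    using chart_domain_sets(1)[OF kA] by auto
  from sets.range_disjointed_sets[OF this] have D_sets: "D i \<in> sets (restrict_space borel FCF)" for i
    using S by (auto simp: D_def)
  have piece: "(\<integral>\<^sup>+x\<in>snd (k i) ` D i. ennreal (s (k i) (chart_inv (k i) x) * coefficient \<omega> (k i) x) \<partial>lborel)
     = (if \<epsilon> = 1 then emeasure (moebius_measure_in c0) (D i) else 0)" for i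
  proof -
    note f = chart_frame_frame_of[OF kA[of i]]
    have img: "snd (k i) ` D i = chart_preimage (k i) (D i)"
      by (rule chart_preimage_eq_image[OF kA D_sub(1)])
    have "s (k i) (chart_inv (k i) x) * coefficient \<omega> (k i) x = \<epsilon> * \<bar>moebius_density (k i) x\<bar>"
      if "x \<in> chart_preimage (k i) (D i)" for x
    proof -
      have x: "x \<in> chart_image (frame_of (k i))" "frame_lines (frame_of (k i)) x \<in> D i"
        using that by (auto simp: chart_preimage_def)
      then have "frame_lines (frame_of (k i)) x \<in> S \<inter> fst (k i)" using D_sub by blast
      from s[OF k(1) this] show ?thesis
        using x(1) by (simp add: chart_inv_eq[OF f] chart_frame_lines[OF f] \<omega>[OF k(1)] mult_sgn_abs abs_sgn mult_ac)
    qed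
    then have "(\<integral>\<^sup>+x\<in>snd (k i) ` D i. ennreal (s (k i) (chart_inv (k i) x) * coefficient \<omega> (k i) x) \<partial>lborel)
      = (\<integral>\<^sup>+x. (if \<epsilon> = 1 then ennreal (indicator (chart_preimage (k i) (D i)) x * \<bar>moebius_density (k i) x\<bar>) else 0) \<partial>lborel)"
      unfolding img using \<epsilon> by (intro nn_integral_cong) (auto simp: indicator_def ennreal_neg)
    also have "\<dots> = (if \<epsilon> = 1 then chart_mass (k i) (D i) else 0)"
      by (simp add: chart_mass_def)
    also have "chart_mass (k i) (D i) = emeasure (moebius_measure_in c0) (D i)"
      using chart_mass_change_of_chart[OF kA c0 D_sets D_sub(1)] emeasure_moebius_measure_in[OF c0 D_sets] by simp
    finally show ?thesis .
  qed
  have "disjoint_family D"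
    unfolding D_def using disjoint_family_disjointed[of "\<lambda>i. fst (k i)"]
    by (auto simp: disjoint_family_on_def)
  moreover have "(\<Union>i. D i) = S"
    using k(2) UN_disjointed_eq[of "\<lambda>i. fst (k i)"] unfolding D_def by blast
  ultimately have sum: "(\<Sum>i. emeasure (moebius_measure_in c0) (D i)) = emeasure (moebius_measure_in c0) S"
    using suminf_emeasure[of D "moebius_measure_in c0"] D_sets by auto
  have "positive_integral \<A> s \<omega> S = (\<Sum>i. if \<epsilon> = 1 then emeasure (moebius_measure_in c0) (D i) else 0)"
    unfolding positive_integral_def k_def[symmetric] Let_def D_def[symmetric] piece ..
  then show ?thesis using sum by auto
qed

lemma abs_form_integral_signed_density:
  assumes \<A>: "\<A> \<subseteq> FCF_atlas" and c0: "c0 \<in> FCF_atlas" and cover: "\<exists>k. chart_cover \<A> S k"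
    and S: "S \<in> sets (restrict_space borel FCF)"
    and \<omega>: "\<And>c x. c \<in> \<A> \<Longrightarrow> x \<in> chart_image (frame_of c) \<Longrightarrow> coefficient \<omega> c x = moebius_density c x"
    and s: "\<And>c p. c \<in> \<A> \<Longrightarrow> p \<in> S \<inter> fst c \<Longrightarrow> s c p = \<epsilon> * sgn (moebius_density c (snd c p))"
    and \<epsilon>: "\<epsilon> \<in> {1, -1}"
  shows "\<bar>form_integral \<A> s \<omega> S\<bar> = enn2ereal (emeasure (moebius_measure_in c0) S)"
proof -
  have "positive_integral \<A> s \<omega> S = (if \<epsilon> = 1 then emeasure (moebius_measure_in c0) S else 0)"
    by (rule positive_integral_signed_density[OF assms])
  moreover have "positive_integral \<A> (\<lambda>c p. - s c p) \<omega> S = (if - \<epsilon> = 1 then emeasure (moebius_measure_in c0) S else 0)"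
    by (rule positive_integral_signed_density[OF \<A> c0 cover S \<omega>]) (use s \<epsilon> in auto)
  ultimately show ?thesis
    using \<epsilon> by (auto simp: form_integral_def zero_ennreal.rep_eq enn2ereal_nonneg)
qed

text \<open>
  A nowhere vanishing form of the highest degree orients the manifold: a chart is positive where the
  coefficient of the form is.
\<close>

definition density_sign :: "('n::finite option proj^'n option, 'n \<times> 'n option) chart \<Rightarrow> 'n option proj^'n option \<Rightarrow> real" where
  "density_sign c p = sgn (moebius_density c (snd c p))"

lemma continuous_on_density_sign:
  assumes c: "c \<in> FCF_atlas"
  shows "continuous_on (fst c) (density_sign c)"
    and "p \<in> fst c \<Longrightarrow> density_sign c p \<in> {1, -1}"
proof -
  note f = chart_frame_frame_of[OF c]
  have "continuous_on (fst c) (\<lambda>p. moebius_density c (snd c p))"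
    by (rule continuous_on_compose2[OF continuous_on_moebius_density continuous_on_chart[OF f]])
      (auto intro: chart_domain_cases[OF f])
  then show "continuous_on (fst c) (density_sign c)"
    unfolding density_sign_def
    using moebius_density_nonzero[OF c chart_domain_cases(1)[OF f]] by (intro continuous_on_sgn) auto
  show "p \<in> fst c \<Longrightarrow> density_sign c p \<in> {1, -1}"
    using moebius_density_nonzero[OF c chart_domain_cases(1)[OF f]] by (auto simp: density_sign_def sgn_if)
qed

lemma orientation_on_density_sign:
  assumes \<A>: "\<A> \<subseteq> FCF_atlas"
  shows "orientation_on \<A> C density_sign"
  unfolding orientation_on_def
proof (intro conjI ballI)
  fix c p assume c: "c \<in> \<A>"
  then have cA: "c \<in> FCF_atlas" using \<A> by auto
  show "continuous_on (C \<inter> fst c) (density_sign c)"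
    by (rule continuous_on_subset[OF continuous_on_density_sign(1)[OF cA]]) auto
  show "p \<in> C \<inter> fst c \<Longrightarrow> density_sign c p \<in> {1, -1}"
    using continuous_on_density_sign(2)[OF cA] by blast
  fix c' assume "c' \<in> \<A>" and p: "p \<in> C \<inter> fst c \<inter> fst c'"
  then have cA': "c' \<in> FCF_atlas" and pc: "p \<in> fst c" "p \<in> fst c'" using \<A> by auto
  note f = chart_frame_frame_of[OF cA] and f' = chart_frame_frame_of[OF cA']
  note x = chart_domain_cases[OF f pc(1)]
  let ?d = "det (matrix (frechet_derivative (snd c' \<circ> chart_inv c) (at (snd c p))))"
  have "frame_coefficient (frame_of c') (snd c' p) * ?d = frame_coefficient (frame_of c) (snd c p)"
    using frame_coefficient_acts_as(2)[OF f f' acts_as_id x(1)] pc(2) x(2) by simp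
  then have m: "moebius_density c (snd c p) = moebius_density c' (snd c' p) * ?d"
    by (simp add: moebius_density_def)
  have "moebius_density c (snd c p) \<noteq> 0" by (rule moebius_density_nonzero[OF cA x(1)])
  then have "?d \<noteq> 0" unfolding m by simp
  then have "sgn ?d * sgn ?d = 1" by (simp add: sgn_if)
  then show "density_sign c' p = sgn ?d * density_sign c p"
    unfolding density_sign_def m by (simp add: sgn_mult)
qed

lemma is_form_measure_moebius:
  assumes \<A>: "\<A> \<subseteq> FCF_atlas" and c0: "c0 \<in> FCF_atlas" and cover: "\<exists>k. chart_cover \<A> (carrier_of \<A>) k"
    and car: "carrier_of \<A> \<in> sets (restrict_space borel FCF)"
    and \<omega>: "\<And>c x. c \<in> \<A> \<Longrightarrow> x \<in> chart_image (frame_of c) \<Longrightarrow> coefficient \<omega> c x = moebius_density c x"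
  shows "is_form_measure \<A> \<omega> (restrict_space (moebius_measure_in c0) (carrier_of \<A>))"
proof -
  have sub: "carrier_of \<A> \<subseteq> FCF" using car sets.sets_into_space[OF car] by (simp add: space_restrict_space)
  show ?thesis
    unfolding is_form_measure_def
  proof (intro conjI ballI)
    show "space (restrict_space (moebius_measure_in c0) (carrier_of \<A>)) = carrier_of \<A>"
      using sub by (auto simp: space_restrict_space)
    show "sets (restrict_space (moebius_measure_in c0) (carrier_of \<A>)) = sets (restrict_space borel (carrier_of \<A>))"
    proof -
      have "sets (restrict_space (moebius_measure_in c0) (carrier_of \<A>)) = sets (restrict_space (restrict_space borel FCF) (carrier_of \<A>))"
        by (rule sets_restrict_space_cong) simp
      then show ?thesis using sub by (simp add: sets_restrict_restrict_space inf_absorb2)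
    qed
    fix C assume "C \<in> components (carrier_of \<A>)"
    then have "C \<subseteq> carrier_of \<A>" by (rule in_components_subset)
    show "\<exists>\<sigma>. orientation_on \<A> C \<sigma> \<and> (\<forall>S. openin (top_of_set (carrier_of \<A>)) S \<and> S \<subseteq> C \<longrightarrow>
        enn2ereal (emeasure (restrict_space (moebius_measure_in c0) (carrier_of \<A>)) S) = \<bar>form_integral \<A> \<sigma> \<omega> S\<bar>)"
    proof (intro exI[of _ density_sign] conjI allI impI)
      show "orientation_on \<A> C density_sign" by (rule orientation_on_density_sign[OF \<A>])
      fix S assume "openin (top_of_set (carrier_of \<A>)) S \<and> S \<subseteq> C"
      then obtain T where T: "open T" "S = carrier_of \<A> \<inter> T" by (auto simp: openin_open)
      have "FCF \<inter> T \<in> sets (restrict_space borel FCF)"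
        using T(1) by (rule restrict_borel_open)
      then have "carrier_of \<A> \<inter> (FCF \<inter> T) \<in> sets (restrict_space borel FCF)" using car by (rule sets.Int[rotated])
      moreover have "carrier_of \<A> \<inter> (FCF \<inter> T) = S" using sub T by auto
      ultimately have S: "S \<in> sets (restrict_space borel FCF)" by simp
      have "emeasure (restrict_space (moebius_measure_in c0) (carrier_of \<A>)) S = emeasure (moebius_measure_in c0) S"
        using car sub T by (intro emeasure_restrict_space) (auto simp: inf_absorb1)
      moreover have "\<exists>k. chart_cover \<A> S k"
        using cover T(2) unfolding chart_cover_def by (meson Int_lower1 order_trans)
      then have "\<bar>form_integral \<A> density_sign \<omega> S\<bar> = enn2ereal (emeasure (moebius_measure_in c0) S)"
        by (rule abs_form_integral_signed_density[OF \<A> c0 _ S \<omega>, where \<epsilon>=1]) (auto simp: density_sign_def)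
      ultimately show "enn2ereal (emeasure (restrict_space (moebius_measure_in c0) (carrier_of \<A>)) S) = \<bar>form_integral \<A> density_sign \<omega> S\<bar>"
        by simp
    qed
  qed
qed

section \<open>A finite cover by charts\<close>

text \<open>
  Finitely many charts cover the manifold, since every line meets some hyperplane \<open>x $ q = 1\<close>. The
  transposition of \<^const>\<open>None\<close> and \<open>q\<close> labels the remaining coordinates by \<open>'n\<close>.
\<close>

definition coordinate_hyperplane :: "'n::finite option \<Rightarrow> (real^'n option) set" where
  "coordinate_hyperplane q = {x. x $ q = 1}"

definition hyperplane_coords :: "'n::finite option \<Rightarrow> real^'n option \<Rightarrow> real^'n" where
  "hyperplane_coords q x = (\<chi> j. x $ Transposition.transpose None q (Some j))"

lemma euclidean_coordinate_hyperplane: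
  fixes q :: "'n::finite option"
  shows "euclidean_hyperplane (coordinate_hyperplane q) (hyperplane_coords q)"
proof -
  let ?P = "coordinate_hyperplane q" and ?e = "hyperplane_coords q" and ?t = "Transposition.transpose None q"
  have P: "?P = {x. axis q 1 \<bullet> x = 1}" by (simp add: coordinate_hyperplane_def inner_axis')
  have dist: "dist (?e x) (?e y) = dist x y" if "x \<in> ?P" "y \<in> ?P" for x y
  proof -
    have "(\<Sum>r\<in>UNIV. (dist (x $ r) (y $ r))\<^sup>2) = (\<Sum>r\<in>UNIV. (dist (x $ ?t r) (y $ ?t r))\<^sup>2)"
      by (rule sum.reindex_bij_betw[symmetric]) (simp add: bij_transpose)
    also have "\<dots> = (\<Sum>j\<in>UNIV. (dist (?e x $ j) (?e y $ j))\<^sup>2)"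
      using that by (simp add: sum_UNIV_option hyperplane_coords_def coordinate_hyperplane_def)
    finally show ?thesis by (simp add: dist_vec_def L2_set_def)
  qed
  have "inj_on ?e ?P"
  proof (rule inj_onI)
    fix x y assume "x \<in> ?P" "y \<in> ?P" "?e x = ?e y"
    then show "x = y" using dist[of x y] by simp
  qed
  moreover have "?e ` ?P = UNIV"
  proof -
    have "\<exists>x\<in>?P. ?e x = y" for y
    proof
      let ?x = "\<chi> r. case ?t r of None \<Rightarrow> 1 | Some j \<Rightarrow> y $ j"
      show "?x \<in> ?P" by (simp add: coordinate_hyperplane_def)
      show "?e ?x = y" by (simp add: hyperplane_coords_def vec_eq_iff)
    qed
    then show ?thesis by (metis UNIV_eq_I image_eqI)
  qed
  moreover have "affine ?P" unfolding P by (rule affine_hyperplane)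
  moreover have "aff_dim ?P = int CARD('n)"
    unfolding P by (subst aff_dim_hyperplane) (simp_all add: axis_eq_0_iff card_option)
  ultimately show ?thesis
    using dist by (auto simp: euclidean_hyperplane_def bij_betw_def coordinate_hyperplane_def)
qed

lemma countable_chart_cover_FCF: "\<exists>k. chart_cover FCF_atlas (FCF :: ('n::finite option proj^'n option) set) k"
proof -
  let ?c = "\<lambda>f :: 'n option \<Rightarrow> 'n option. FCF_chart (\<lambda>i. coordinate_hyperplane (f i)) (\<lambda>i. hyperplane_coords (f i))"
  have fin: "countable (range ?c)" by (simp add: countable_finite)
  have atlas: "range ?c \<subseteq> FCF_atlas"
    unfolding FCF_atlas_def using euclidean_coordinate_hyperplane by blast
  have cov: "l \<in> (\<Union>f. fst (?c f))" if "l \<in> FCF" for l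
  proof -
    have "\<exists>q. line_set (l $ i) \<inter> coordinate_hyperplane q \<noteq> {}" for i
    proof -
      obtain v where v: "v \<noteq> 0" "l $ i = line_of v" by (rule line_of_cases)
      then obtain q where "v $ q \<noteq> 0" by (auto simp: vec_eq_iff)
      then have "inverse (v $ q) *\<^sub>R v \<in> line_set (l $ i) \<inter> coordinate_hyperplane q"
        using v by (simp add: line_set_line_of coordinate_hyperplane_def span_mul span_base)
      then show ?thesis by blast
    qed
    then obtain f where "\<And>i. line_set (l $ i) \<inter> coordinate_hyperplane (f i) \<noteq> {}" by metis
    then have "l \<in> fst (?c f)" using that by (simp add: FCF_chart_def)
    then show ?thesis by blast
  qed
  have r: "range (from_nat_into (range ?c)) = range ?c"
    using fin by (intro range_from_nat_into) auto
  have "(\<Union>i. fst (from_nat_into (range ?c) i)) = (\<Union>f. fst (?c f))"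
    using arg_cong[OF r, of "\<lambda>A. \<Union> (fst ` A)"] by (simp only: image_image)
  then show ?thesis
    unfolding chart_cover_def using r atlas cov
    by (intro exI[of _ "from_nat_into (range ?c)"]) (simp add: subset_iff)
qed

lemma carrier_FCF_atlas: "carrier_of FCF_atlas = FCF"
proof
  show "carrier_of FCF_atlas \<subseteq> FCF"
    unfolding carrier_of_def using chart_domain_sets(2) by blast
  show "FCF \<subseteq> carrier_of FCF_atlas"
    using countable_chart_cover_FCF unfolding chart_cover_def carrier_of_def by blast
qed

lemma Moebius_measure_in_chart:
  assumes c0: "c0 \<in> FCF_atlas"
  shows "Moebius_measure (moebius_measure_in c0)"
proof -
  have FCF: "FCF \<in> sets (restrict_space borel FCF)"
    using restrict_borel_open[of UNIV FCF] by simp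
  have "is_form_measure FCF_atlas the_moebius_form (restrict_space (moebius_measure_in c0) (carrier_of FCF_atlas))"
    by (rule is_form_measure_moebius[OF _ c0])
      (use countable_chart_cover_FCF FCF in \<open>simp_all add: carrier_FCF_atlas coefficient_the_moebius_form\<close>)
  moreover have "restrict_space (moebius_measure_in c0) FCF = moebius_measure_in c0"
  proof (rule measure_eqI)
    show "sets (restrict_space (moebius_measure_in c0) FCF) = sets (moebius_measure_in c0)"
      by (simp add: sets_restrict_space image_comp)
    show "emeasure (restrict_space (moebius_measure_in c0) FCF) S = emeasure (moebius_measure_in c0) S"
      if "S \<in> sets (restrict_space (moebius_measure_in c0) FCF)" for S
      using that sets.sets_into_space[OF that] FCF
      by (intro emeasure_restrict_space) (auto simp: space_restrict_space)
  qed
  ultimately show ?thesis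
    unfolding Moebius_measure_def carrier_FCF_atlas using Moebius_form_the_moebius_form by metis
qed

section \<open>The form of a hyperplane and the uniqueness of its measure\<close>

text \<open>
  All lines use the same frame \<open>N\<close>, so \<open>det N ^ (n + 1)\<close> cancels and what remains is the determinant of
  the vectors \<open>(1, A i)\<close>.
\<close>

lemma coefficient_omega_plane:
  fixes P :: "(real^'n::finite option) set" and e :: "real^'n option \<Rightarrow> real^'n"
  assumes Pe: "euclidean_hyperplane P e"
  defines "c0 \<equiv> FCF_chart (\<lambda>_. P) (\<lambda>_. e)"
  assumes x: "x \<in> chart_image (frame_of c0)"
  shows "coefficient omega_plane c0 x = moebius_density c0 x"
proof -
  have c0: "c0 \<in> FCF_atlas" unfolding c0_def FCF_atlas_def using Pe by blast
  obtain N where N: "affine_frame P e N" by (rule euclidean_hyperplane_affine_frame[OF Pe])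
  have f: "chart_frame c0 (\<lambda>_. N)" unfolding c0_def by (rule chart_frame_FCF_chart[OF N])
  have "det N \<noteq> 0" using N by (simp add: affine_frame_def invertible_det_nz)
  have "(\<chi> i. frame_vector (\<lambda>_. N) x i) = (\<chi> i. hom (coords_of x i)) ** Finite_Cartesian_Product.transpose N"
    by (simp add: vec_eq_iff frame_vector_def matrix_matrix_mult_def matrix_vector_mult_def
        Finite_Cartesian_Product.transpose_def mult.commute)
  then have "frame_det (\<lambda>_. N) x = fact CARD('n) * oriented_volume (coords_of x) * det N"
    unfolding frame_det_def by (simp only: det_mul det_transpose det_hom)
  then have "frame_coefficient (\<lambda>_. N) x =
      1 / (fact CARD('n) ^ (CARD('n) + 1) * oriented_volume (coords_of x) ^ (CARD('n) + 1))"
    using \<open>det N \<noteq> 0\<close> by (simp add: frame_coefficient_def card_option power_mult_distrib field_simps)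
  then have "moebius_density c0 x = 1 / oriented_volume (coords_of x) ^ (CARD('n) + 1)"
    unfolding moebius_density_def frame_coefficient_unique[OF chart_frame_frame_of[OF c0] f x] by simp
  moreover have "coords_of x = (\<lambda>i. \<chi> j. x $ (j, i))" by (simp add: coords_of_def fun_eq_iff)
  ultimately show ?thesis
    by (simp add: coefficient_def omega_plane_def wedge_dx_axis)
qed

lemma locally_constant_sign:
  fixes f :: "'a::topological_space \<Rightarrow> real"
  assumes "connected X" "continuous_on X f" "\<And>p. p \<in> X \<Longrightarrow> f p \<in> {1, -1}"
  obtains \<epsilon> where "\<epsilon> \<in> {1, -1}" "\<And>p. p \<in> X \<Longrightarrow> f p = \<epsilon>"
proof -
  have "connected (f ` X)" using assms by (intro connected_continuous_image)
  moreover have "finite (f ` X)" by (rule finite_subset[of _ "{1, -1}"]) (use assms(3) in auto)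
  ultimately consider "f ` X = {}" | a where "f ` X = {a}" using connected_finite_iff_sing by blast
  then show ?thesis
  proof cases
    case 1
    then show ?thesis using that[of 1] by auto
  next
    case 2
    then show ?thesis using that[of a] assms(3) by (metis image_iff insertI1 singletonD)
  qed
qed

context
  fixes c0 :: "('n::finite option proj^'n option, 'n \<times> 'n option) chart"
  assumes c0: "c0 \<in> FCF_atlas"
begin

abbreviation (input) "F0 \<equiv> frame_lines (frame_of c0)"
abbreviation (input) "U0 \<equiv> chart_image (frame_of c0)"

lemmas f0 = chart_frame_frame_of[OF c0]

text \<open>
  A generator of the Borel sets of the chart domain on which the value of a form measure can be computed:
  boxes are connected, so each lies in one component, on which the orientation and the sign of the density
  are constant; and they are small enough to have finite mass.
\<close>

definition finite_boxes where
  "finite_boxes = {box a b | a b. box a b \<subseteq> U0 \<and> chart_mass c0 (F0 ` box a b) \<noteq> \<infinity>}"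

lemma image_F0_eq: "X \<subseteq> U0 \<Longrightarrow> F0 ` X = fst c0 \<inter> snd c0 -` X"
proof
  assume X: "X \<subseteq> U0"
  show "F0 ` X \<subseteq> fst c0 \<inter> snd c0 -` X"
    using X frame_lines_in_domain[OF f0] chart_frame_lines[OF f0] by auto
  show "fst c0 \<inter> snd c0 -` X \<subseteq> F0 ` X"
    using chart_domain_cases(2)[OF f0] by blast
qed

lemma image_F0_preimage: "X \<subseteq> U0 \<Longrightarrow> chart_preimage c0 (F0 ` X) = X"
proof -
  assume X: "X \<subseteq> U0"
  have "inj_on F0 U0" by (rule inj_on_inverseI[of _ "snd c0"]) (rule chart_frame_lines[OF f0])
  then show ?thesis using X by (auto simp: chart_preimage_def inj_on_def)
qed

lemma image_F0_openin: "open X \<Longrightarrow> X \<subseteq> U0 \<Longrightarrow> openin (top_of_set (fst c0)) (F0 ` X)"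
  by (simp add: image_F0_eq continuous_openin_preimage_gen continuous_on_chart[OF f0])

lemma image_F0_sets: "open X \<Longrightarrow> X \<subseteq> U0 \<Longrightarrow> F0 ` X \<in> sets (restrict_space borel (fst c0))"
  using image_F0_openin[of X] by (auto simp: openin_open intro: restrict_borel_open)

lemma sets_restrict_chart:
  assumes "S \<in> sets (restrict_space borel (fst c0))"
  shows "S \<in> sets (restrict_space borel FCF)"
proof -
  obtain T where T: "open T" "fst c0 = FCF \<inter> T"
    using openin_chart_domain[OF f0] by (elim exE conjE) (rule that)
  obtain S' where S': "S' \<in> sets borel" "S = fst c0 \<inter> S'" using assms by (auto simp: sets_restrict_space)
  have "S = FCF \<inter> (T \<inter> S')" using S' T by auto
  moreover have "T \<inter> S' \<in> sets borel" by (rule sets.Int[OF borel_open[OF T(1)] S'(1)])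
  ultimately show ?thesis unfolding sets_restrict_space by (metis imageI)
qed

lemma finite_boxes_cover:
  assumes "open X" "X \<subseteq> U0"
  obtains \<B> where "\<B> \<subseteq> finite_boxes" "countable \<B>" "\<Union>\<B> = X"
proof -
  define \<F> where "\<F> = {B \<in> finite_boxes. B \<subseteq> X}"
  have "\<Union>\<F> = X"
  proof
    show "X \<subseteq> \<Union>\<F>"
    proof
      fix x assume "x \<in> X"
      then obtain r where r: "r > 0" "cball x r \<subseteq> X" using assms(1) open_contains_cball by metis
      \<comment> \<open>The density is bounded on a closed ball inside the open set, hence a box in that ball has finite mass.\<close>
      obtain a b where ab: "x \<in> box a b" "box a b \<subseteq> ball x r" using rational_boxes[OF r(1)] by blast
      have sub: "box a b \<subseteq> cball x r" "box a b \<subseteq> U0" using ab r(2) assms(2) ball_subset_cball by blast+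
      have "compact (moebius_density c0 ` cball x r)"
        using r(2) assms(2) by (intro compact_continuous_image continuous_on_subset[OF continuous_on_moebius_density]) auto
      from compact_imp_bounded[OF this] obtain M where M: "\<And>y. y \<in> cball x r \<Longrightarrow> \<bar>moebius_density c0 y\<bar> \<le> M"
        unfolding bounded_iff by fastforce
      have "chart_mass c0 (F0 ` box a b) \<le> (\<integral>\<^sup>+y. ennreal M * indicator (box a b) y \<partial>lborel)"
        unfolding chart_mass_def image_F0_preimage[OF sub(2)]
        using M sub(1) by (intro nn_integral_mono) (auto simp: indicator_def intro!: ennreal_leI)
      also have "\<dots> = ennreal M * emeasure lborel (box a b)" by (simp add: nn_integral_cmult_indicator)
      also have "\<dots> < \<infinity>"
        using emeasure_bounded_finite[OF bounded_box[of a b]] by (simp add: ennreal_mult_less_top)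
      finally have "box a b \<in> finite_boxes" using sub(2) unfolding finite_boxes_def by force
      moreover have "box a b \<subseteq> X" using sub(1) r(2) by blast
      ultimately show "x \<in> \<Union>\<F>" using ab(1) by (auto simp: \<F>_def)
    qed
  qed (auto simp: \<F>_def)
  moreover have "\<And>B. B \<in> \<F> \<Longrightarrow> open B" by (auto simp: \<F>_def finite_boxes_def)
  then obtain \<B> where "\<B> \<subseteq> \<F>" "countable \<B>" "\<Union>\<B> = \<Union>\<F>" by (rule Lindelof)
  ultimately show ?thesis using that[of \<B>] by (auto simp: \<F>_def)
qed

lemma finite_boxesD: "B \<in> finite_boxes \<Longrightarrow> open B \<and> B \<subseteq> U0 \<and> connected B \<and> chart_mass c0 (F0 ` B) \<noteq> \<infinity>"
  by (auto simp: finite_boxes_def convex_connected convex_box)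

lemma chart_mass_mono: "S \<subseteq> S' \<Longrightarrow> chart_mass c0 S \<le> chart_mass c0 S'"
  unfolding chart_mass_def by (intro nn_integral_mono ennreal_leI) (auto simp: indicator_def chart_preimage_def)

lemma Int_stable_finite_boxes: "Int_stable ((`) F0 ` finite_boxes)"
proof (rule Int_stableI)
  fix X Y assume "X \<in> (`) F0 ` finite_boxes" "Y \<in> (`) F0 ` finite_boxes"
  then obtain a b c d where X: "X = F0 ` box a b" "box a b \<subseteq> U0" "chart_mass c0 (F0 ` box a b) \<noteq> \<infinity>"
    and Y: "Y = F0 ` box c d" "box c d \<subseteq> U0"
    by (auto simp: finite_boxes_def)
  have XY: "X \<inter> Y = F0 ` (box a b \<inter> box c d)"
    using X Y by (auto simp: image_F0_eq le_infI1)
  have "chart_mass c0 (F0 ` (box a b \<inter> box c d)) \<le> chart_mass c0 (F0 ` box a b)"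
    by (rule chart_mass_mono) auto
  then have "chart_mass c0 (F0 ` (box a b \<inter> box c d)) \<noteq> \<infinity>" using X(3) by (auto simp: top_unique)
  moreover have "box a b \<inter> box c d \<subseteq> U0" using X(2) by auto
  ultimately have "box a b \<inter> box c d \<in> finite_boxes"
    unfolding finite_boxes_def box_Int_box by blast
  then show "X \<inter> Y \<in> (`) F0 ` finite_boxes" unfolding XY by blast
qed

text \<open>
  By the Lindelof property an open set of coordinates is a countable union of such boxes. So the coordinate
  map is already measurable for the generated sigma-algebra, and every Borel set of the chart domain is the
  preimage of a Borel set of coordinates.
\<close>

lemma sets_chart_generated: "sets (restrict_space borel (fst c0)) = sigma_sets (fst c0) ((`) F0 ` finite_boxes)"
proof
  let ?E = "(`) F0 ` finite_boxes"
  have E: "?E \<subseteq> sets (restrict_space borel (fst c0))"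
    using finite_boxesD image_F0_sets by blast
  then show "sigma_sets (fst c0) ?E \<subseteq> sets (restrict_space borel (fst c0))"
    using sets.sigma_sets_subset[OF E] by (simp add: space_restrict_space)
  have Pow: "?E \<subseteq> Pow (fst c0)" using finite_boxesD image_F0_eq by blast
  let ?M = "sigma (fst c0) ?E"
  have open_img: "F0 ` X \<in> sets ?M" if X: "open X" "X \<subseteq> U0" for X
  proof -
    obtain \<B> where B: "\<B> \<subseteq> finite_boxes" "countable \<B>" "\<Union>\<B> = X" by (rule finite_boxes_cover[OF X])
    have "F0 ` X = (\<Union>B\<in>\<B>. F0 ` B)" using B(3) by auto
    moreover have "F0 ` B \<in> sets ?M" if "B \<in> \<B>" for B
    proof -
      have "F0 ` B \<in> ?E" using that B(1) by (intro imageI) (rule subsetD)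
      then show ?thesis unfolding sets_measure_of[OF Pow] by (rule sigma_sets.Basic)
    qed
    ultimately show ?thesis using B(2) by auto
  qed
  have "snd c0 \<in> borel_measurable ?M"
  proof (rule borel_measurableI)
    fix X :: "(real^('n \<times> 'n option)) set" assume "open X"
    have "snd c0 -` X \<inter> space ?M = F0 ` (X \<inter> U0)"
      using Pow chart_domain_cases(1)[OF f0] by (auto simp: image_F0_eq space_measure_of)
    then show "snd c0 -` X \<inter> space ?M \<in> sets ?M"
      using open_img \<open>open X\<close> by (simp add: open_Int open_chart_image)
  qed
  show "sets (restrict_space borel (fst c0)) \<subseteq> sigma_sets (fst c0) ?E"
  proof
    fix S assume S: "S \<in> sets (restrict_space borel (fst c0))"
    then have Ssub: "S \<subseteq> fst c0" using sets.sets_into_space by (fastforce simp: space_restrict_space)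
    have "chart_preimage c0 S \<in> sets borel"
      by (rule chart_preimage_sets[OF c0 sets_restrict_chart[OF S]])
    from measurable_sets[OF \<open>snd c0 \<in> borel_measurable ?M\<close> this]
    have "snd c0 -` chart_preimage c0 S \<inter> fst c0 \<in> sets ?M" using Pow by (simp add: space_measure_of)
    moreover have "snd c0 -` chart_preimage c0 S \<inter> fst c0 = S"
      using Ssub chart_domain_cases[OF f0] by (auto simp: chart_preimage_def)
    ultimately show "S \<in> sigma_sets (fst c0) ?E" using Pow by (simp add: sets_measure_of)
  qed
qed

text \<open>
  A measure of the form may use any orientation on each component. On a box any orientation agrees with
  \<^const>\<open>density_sign\<close> up to a constant sign, which the absolute value removes. So two measures of the form
  agree on boxes, and thus everywhere.
\<close>

lemma form_measure_unique:
  assumes \<omega>: "\<And>x. x \<in> U0 \<Longrightarrow> coefficient \<omega> c0 x = moebius_density c0 x"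
    and \<mu>: "is_form_measure {c0} \<omega> \<mu>"
  shows "\<mu> = restrict_space (moebius_measure_in c0) (fst c0)"
proof -
  let ?\<nu> = "moebius_measure_in c0" and ?E = "(`) F0 ` finite_boxes"
  have car: "carrier_of {c0} = fst c0" by (simp add: carrier_of_def)
  note dom = chart_domain_sets[OF c0]
  have cover: "\<exists>k. chart_cover {c0} S k" if "S \<subseteq> fst c0" for S
    using that by (intro exI[of _ "\<lambda>_. c0"]) (auto simp: chart_cover_def)
  have \<nu>_eq: "emeasure (restrict_space ?\<nu> (fst c0)) S = chart_mass c0 S"
    if "S \<in> sets (restrict_space borel (fst c0))" for S
  proof -
    have "S \<subseteq> fst c0" using sets.sets_into_space[OF that] by (simp add: space_restrict_space)
    then have "emeasure (restrict_space ?\<nu> (fst c0)) S = emeasure ?\<nu> S"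
      using dom by (intro emeasure_restrict_space) (auto simp: inf_absorb1)
    then show ?thesis using emeasure_moebius_measure_in[OF c0 sets_restrict_chart[OF that]] by simp
  qed
  have sets_\<nu>: "sets (restrict_space ?\<nu> (fst c0)) = sets (restrict_space borel (fst c0))"
  proof -
    have "sets (restrict_space ?\<nu> (fst c0)) = sets (restrict_space (restrict_space borel FCF) (fst c0))"
      by (rule sets_restrict_space_cong) simp
    then show ?thesis using dom(2) by (simp add: sets_restrict_restrict_space inf_absorb2)
  qed
  have same: "emeasure \<mu> X = emeasure (restrict_space ?\<nu> (fst c0)) X" if XE: "X \<in> ?E" for X
  proof -
    obtain B where B: "X = F0 ` B" "open B" "B \<subseteq> U0" "connected B" using XE finite_boxesD by blast
    have Xb: "X \<in> sets (restrict_space borel (fst c0))" using B image_F0_sets by simp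
    have Xsub: "X \<subseteq> fst c0" using B image_F0_eq by auto
    have conn: "connected X"
      unfolding B(1) by (rule connected_continuous_image[OF continuous_on_frame_lines[OF f0] B(4)])
    show ?thesis
    proof (cases "X = {}")
      case False
      then have "fst c0 \<noteq> {}" using Xsub by auto
      then obtain C where C: "C \<in> components (fst c0)" "X \<subseteq> C"
        using exists_component_superset[OF Xsub _ conn] by blast
      have "\<forall>C\<in>components (fst c0). \<exists>\<sigma>. orientation_on {c0} C \<sigma> \<and>
          (\<forall>S. openin (top_of_set (fst c0)) S \<and> S \<subseteq> C \<longrightarrow>
            enn2ereal (emeasure \<mu> S) = \<bar>form_integral {c0} \<sigma> \<omega> S\<bar>)"
        using \<mu> unfolding is_form_measure_def car by (elim conjE)
      from bspec[OF this C(1)] obtain \<sigma> where \<sigma>: "orientation_on {c0} C \<sigma>"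
        and eq: "\<forall>S. openin (top_of_set (fst c0)) S \<and> S \<subseteq> C \<longrightarrow>
            enn2ereal (emeasure \<mu> S) = \<bar>form_integral {c0} \<sigma> \<omega> S\<bar>"
        by (elim exE conjE) (rule that)
      have \<sigma>c: "continuous_on (C \<inter> fst c0) (\<sigma> c0)"
        and \<sigma>1: "\<And>p. p \<in> C \<inter> fst c0 \<Longrightarrow> \<sigma> c0 p \<in> {1, -1}"
        using \<sigma> unfolding orientation_on_def by blast+
      have XC: "X \<subseteq> C \<inter> fst c0" using C(2) Xsub by blast
      have cont: "continuous_on X (\<lambda>p. \<sigma> c0 p * density_sign c0 p)"
        by (rule continuous_on_mult[OF continuous_on_subset[OF \<sigma>c XC]
              continuous_on_subset[OF continuous_on_density_sign(1)[OF c0] Xsub]])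
      have ds: "density_sign c0 p \<in> {1, -1}" if "p \<in> X" for p
        using that Xsub continuous_on_density_sign(2)[OF c0] by blast
      have s1: "\<sigma> c0 p * density_sign c0 p \<in> {1, -1}" if "p \<in> X" for p
        using ds[OF that] \<sigma>1[OF subsetD[OF XC that]] by auto
      obtain \<epsilon> where \<epsilon>: "\<epsilon> \<in> {1, -1}" "\<And>p. p \<in> X \<Longrightarrow> \<sigma> c0 p * density_sign c0 p = \<epsilon>"
        using locally_constant_sign[OF conn cont s1, of thesis] by blast
      have "\<sigma> c0 p = \<epsilon> * density_sign c0 p" if "p \<in> X" for p
        using ds[OF that] \<epsilon>(2)[OF that] by auto
      then have "\<bar>form_integral {c0} \<sigma> \<omega> X\<bar> = enn2ereal (emeasure ?\<nu> X)"
        using c0 \<omega> \<epsilon>(1)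
        by (intro abs_form_integral_signed_density[OF _ c0 cover[OF Xsub] sets_restrict_chart[OF Xb], where \<omega>=\<omega> and s=\<sigma> and \<epsilon>=\<epsilon>])
           (auto simp: density_sign_def)
      then have "enn2ereal (emeasure \<mu> X) = enn2ereal (emeasure ?\<nu> X)"
        using eq[rule_format, of X] C(2) B image_F0_openin by simp
      then have "emeasure \<mu> X = emeasure ?\<nu> X" by (simp add: enn2ereal_inject)
      then show ?thesis
        using \<nu>_eq[OF Xb] emeasure_moebius_measure_in[OF c0 sets_restrict_chart[OF Xb]] by simp
    qed simp
  qed
  obtain \<B> where \<B>: "\<B> \<subseteq> finite_boxes" "countable \<B>" "\<Union>\<B> = U0"
    by (rule finite_boxes_cover[OF open_chart_image order_refl])
  show ?thesis
  proof (rule measure_eqI_generator_eq_countable[where \<Omega>="fst c0" and E="?E" and A="(`) F0 ` \<B>"])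
    show "Int_stable ?E" by (rule Int_stable_finite_boxes)
    show "?E \<subseteq> Pow (fst c0)" using finite_boxesD image_F0_eq by blast
    show "sets \<mu> = sigma_sets (fst c0) ?E"
      using \<mu> by (simp add: is_form_measure_def car sets_chart_generated[symmetric])
    show "sets (restrict_space ?\<nu> (fst c0)) = sigma_sets (fst c0) ?E"
      unfolding sets_\<nu> by (rule sets_chart_generated)
    show "(`) F0 ` \<B> \<subseteq> ?E" using \<B>(1) by blast
    have "\<Union> ((`) F0 ` \<B>) = F0 ` U0" unfolding \<B>(3)[symmetric] by blast
    also have "\<dots> = fst c0 \<inter> snd c0 -` U0" by (rule image_F0_eq) simp
    also have "\<dots> = fst c0" using chart_domain_cases(1)[OF f0] by blast
    finally show "\<Union> ((`) F0 ` \<B>) = fst c0" .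
    show "countable ((`) F0 ` \<B>)" using \<B>(2) by simp
    show "emeasure \<mu> X \<noteq> \<infinity>" if X: "X \<in> (`) F0 ` \<B>" for X
    proof -
      obtain B where B: "B \<in> finite_boxes" "X = F0 ` B" using X \<B>(1) by blast
      then have "X \<in> sets (restrict_space borel (fst c0))" using finite_boxesD image_F0_sets by blast
      then show ?thesis using same[of X] \<nu>_eq[of X] finite_boxesD[OF B(1)] B by simp
    qed
  qed (rule same)
qed

end

text \<open>
  The chart of the hyperplane is one of the charts of the atlas, and in it the Moebius form is
  \<^const>\<open>omega_plane\<close>. So the Moebius measure transported from this chart restricts to the measure of
  \<^const>\<open>omega_plane\<close>, which is unique.
\<close>

theorem proposition4p1:
  fixes P :: "(real^'n::finite option) set"
    and e :: "real^'n option \<Rightarrow> real^'n"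
  assumes "euclidean_hyperplane P e"
  shows "\<exists>\<nu>. Moebius_measure \<nu> \<and>
           (\<forall>\<mu>. is_form_measure (FCF_plane_atlas P e) omega_plane \<mu> \<longleftrightarrow>
                 \<mu> = restrict_space \<nu> (FCF_plane P))"
proof -
  define c0 where "c0 = FCF_chart (\<lambda>_. P) (\<lambda>_. e)"
  have c0: "c0 \<in> FCF_atlas" unfolding c0_def FCF_atlas_def using assms by blast
  have plane: "FCF_plane P = fst c0" "FCF_plane_atlas P e = {c0}"
    by (simp_all add: c0_def FCF_plane_def FCF_plane_atlas_def FCF_chart_def)
  have \<omega>: "coefficient omega_plane c0 x = moebius_density c0 x" if "x \<in> chart_image (frame_of c0)" for x
    using coefficient_omega_plane[OF assms] that by (simp add: c0_def)
  have car: "carrier_of {c0} = fst c0" by (simp add: carrier_of_def)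
  have "\<exists>k. chart_cover {c0} (carrier_of {c0}) k"
    by (intro exI[of _ "\<lambda>_. c0"]) (simp add: chart_cover_def car)
  then have "is_form_measure {c0} omega_plane (restrict_space (moebius_measure_in c0) (fst c0))"
    using is_form_measure_moebius[of "{c0}" c0 omega_plane] c0 chart_domain_sets(1)[OF c0] \<omega>
    by (simp add: car)
  then have "\<forall>\<mu>. is_form_measure (FCF_plane_atlas P e) omega_plane \<mu> \<longleftrightarrow>
       \<mu> = restrict_space (moebius_measure_in c0) (FCF_plane P)"
    unfolding plane using form_measure_unique[OF c0 \<omega>] by blast
  then show ?thesis using Moebius_measure_in_chart[OF c0] by blast
qed

end
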